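(* Let $r\ge3$ and let $n$ be sufficiently large (depending on $r$). Let $G$ be a graph with the maximum second largest eigenvalue $\lambda_2$ among all $K_r$-minor-free connected graphs on $n$ vertices. Then $$G\in\begin{cases}\mathcal I\big(G^*(\tfrac{n-1}{2},K_r\text{-minor}),\,G^*(\tfrac{n-1}{2},K_r\text{-minor})\big),&\text{when } n \text{ is odd};\\ \mathcal E(H_1,H_2),&\text{when } n\text{ is even},\end{cases}$$ where $H_1$ and $H_2$ are some $K_r$-minor-saturated graphs, each on $\frac n2$ vertices.
   Context: Graphs are finite and simple; $\lambda_2(G)$ is the second largest adjacency eigenvalue (with multiplicity). A graph is $K_r$-minor-free if it does not contain $K_r$ as a minor (in the usual sense), and $K_r$-minor-saturated if it is $K_r$-minor-free but adding any non-edge creates a $K_r$ minor. $G^*(m,K_r\text{-minor})$ is the graph with the maximum spectral radius among $K_r$-minor-free graphs on $m$ vertices; for $m$ sufficiently large it is known (Tait) to be $K_{r-2}\vee K^c_{m-r+2}$, where $\vee$ is the join and $K^c_p$ is the edgeless graph on $p$ vertices. For disjoint graphs $A,B$: $\mathcal I(A,B)$ is the family of connected graphs obtained from the disjoint union of $A$ and $B$ by adding one new vertex and joining it to some vertices of $A$ and some vertices of $B$; $\mathcal E(A,B)$ is the family of graphs obtained from the disjoint union of $A$ and $B$ by adding one new edge between a vertex of $A$ and a vertex of $B$. *)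

theory Defs
  imports
    "Graph_Theory.Graph_Theory"
    "Jordan_Normal_Form.Spectral_Radius"
    "HOL-Computational_Algebra.Polynomial"
begin

text \<open>
  A finite simple graph is a \<open>pair_graph\<close> of the Graph Theory library: a finite loop-free symmetric
  digraph without parallel arcs, each edge \<open>uv\<close> being present as the two arcs \<open>(u, v)\<close>, \<open>(v, u)\<close>.
\<close>

subsection \<open>Adjacency spectrum\<close>

text \<open>
  Rows and columns are indexed by the vertices in increasing order; the spectrum does not depend
  on this choice.
\<close>

definition adjacency_mat :: "'a::linorder pair_pre_digraph \<Rightarrow> 'b::{zero,one} mat" where
  "adjacency_mat G =
     (let vs = sorted_list_of_set (pverts G) in
      mat (length vs) (length vs) (\<lambda>(i, j). if (vs ! i, vs ! j) \<in> parcs G then 1 else 0))"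

text \<open>
  All eigenvalues, repeated according to their multiplicity, in non-increasing order. The
  characteristic polynomial of a real symmetric matrix splits over the reals, so its multiset of
  real roots is the whole spectrum.
\<close>

definition graph_eigenvalues :: "'a::linorder pair_pre_digraph \<Rightarrow> real list" where
  "graph_eigenvalues G = rev (sorted_list_of_multiset (proots (char_poly (adjacency_mat G))))"

definition lambda2 :: "'a::linorder pair_pre_digraph \<Rightarrow> real" where
  "lambda2 G = graph_eigenvalues G ! 1"

definition graph_spectral_radius :: "'a::linorder pair_pre_digraph \<Rightarrow> real" where
  "graph_spectral_radius G = spectral_radius (adjacency_mat G)"

subsection \<open>Minors\<close>

text \<open>
  \<open>H\<close> is a minor of \<open>G\<close> if it has a model in \<open>G\<close>: pairwise disjoint connected branch sets, one for
  each vertex of \<open>H\<close>, with an edge of \<open>G\<close> between any two branch sets whose vertices are adjacent in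
  \<open>H\<close>. Connectedness in the library includes being non-empty.
\<close>

definition is_minor :: "'b pair_pre_digraph \<Rightarrow> 'a pair_pre_digraph \<Rightarrow> bool" where
  "is_minor H G \<longleftrightarrow>
     (\<exists>B :: 'b \<Rightarrow> 'a set.
        (\<forall>x \<in> pverts H. B x \<subseteq> pverts G \<and> Digraph_Component.connected (with_proj G \<restriction> B x)) \<and>
        (\<forall>x \<in> pverts H. \<forall>y \<in> pverts H. x \<noteq> y \<longrightarrow> B x \<inter> B y = {}) \<and>
        (\<forall>(x, y) \<in> parcs H. \<exists>u \<in> B x. \<exists>v \<in> B y. (u, v) \<in> parcs G))"

definition K_minor_free :: "nat \<Rightarrow> 'a pair_pre_digraph \<Rightarrow> bool" where
  "K_minor_free r G \<longleftrightarrow>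
     \<not> (\<exists>K :: nat pair_pre_digraph. complete_digraph r (with_proj K) \<and> is_minor K G)"

definition add_edge :: "'a pair_pre_digraph \<Rightarrow> 'a \<Rightarrow> 'a \<Rightarrow> 'a pair_pre_digraph" where
  "add_edge G u v = \<lparr>pverts = pverts G, parcs = parcs G \<union> {(u, v), (v, u)}\<rparr>"

definition K_minor_saturated :: "nat \<Rightarrow> 'a pair_pre_digraph \<Rightarrow> bool" where
  "K_minor_saturated r G \<longleftrightarrow>
     K_minor_free r G \<and>
     (\<forall>u \<in> pverts G. \<forall>v \<in> pverts G.
        u \<noteq> v \<and> (u, v) \<notin> parcs G \<longrightarrow> \<not> K_minor_free r (add_edge G u v))"

subsection \<open>Extremal graphs\<close>

text \<open>
  \<open>is_Gstar r m A\<close> says that \<open>A\<close> is \<open>G*(m, K\<^sub>r-minor)\<close>, that is, a graph of maximum spectral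
  radius among the \<open>K\<^sub>r\<close>-minor-free graphs on \<open>m\<close> vertices. Graphs are taken up to isomorphism,
  so this is a predicate: each copy of the extremal graph satisfies it. By a theorem of Tait, for
  large \<open>m\<close> the extremal graph is unique up to isomorphism.
\<close>

definition is_Gstar :: "nat \<Rightarrow> nat \<Rightarrow> nat pair_pre_digraph \<Rightarrow> bool" where
  "is_Gstar r m A \<longleftrightarrow>
     pair_graph A \<and> card (pverts A) = m \<and> K_minor_free r A \<and>
     (\<forall>A' :: nat pair_pre_digraph. pair_graph A' \<and> card (pverts A') = m \<and> K_minor_free r A' \<longrightarrow>
        graph_spectral_radius A' \<le> graph_spectral_radius A)"

definition max_lambda2 :: "nat \<Rightarrow> nat \<Rightarrow> nat pair_pre_digraph \<Rightarrow> bool" where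
  "max_lambda2 r n G \<longleftrightarrow>
     pair_graph G \<and> card (pverts G) = n \<and> Digraph_Component.connected (with_proj G) \<and>
     K_minor_free r G \<and>
     (\<forall>G' :: nat pair_pre_digraph. pair_graph G' \<and> card (pverts G') = n \<and> Digraph_Component.connected (with_proj G') \<and>
        K_minor_free r G' \<longrightarrow> lambda2 G' \<le> lambda2 G)"

subsection \<open>The families of graphs built from two disjoint graphs\<close>

definition graph_union :: "'a pair_pre_digraph \<Rightarrow> 'a pair_pre_digraph \<Rightarrow> 'a pair_pre_digraph" where
  "graph_union A B = \<lparr>pverts = pverts A \<union> pverts B, parcs = parcs A \<union> parcs B\<rparr>"

definition join_new_vertex :: "'a pair_pre_digraph \<Rightarrow> 'a \<Rightarrow> 'a set \<Rightarrow> 'a pair_pre_digraph" where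
  "join_new_vertex G w S =
     \<lparr>pverts = insert w (pverts G), parcs = parcs G \<union> {w} \<times> S \<union> S \<times> {w}\<rparr>"

text \<open>The two families are meant for graphs \<open>A\<close>, \<open>B\<close> with disjoint vertex sets.\<close>

definition I_family :: "'a pair_pre_digraph \<Rightarrow> 'a pair_pre_digraph \<Rightarrow> 'a pair_pre_digraph set" where
  "I_family A B =
     {join_new_vertex (graph_union A B) w (S \<union> T) | w S T.
        w \<notin> pverts A \<union> pverts B \<and> S \<subseteq> pverts A \<and> T \<subseteq> pverts B \<and>
        Digraph_Component.connected
          (with_proj (join_new_vertex (graph_union A B) w (S \<union> T)))}"

definition E_family :: "'a pair_pre_digraph \<Rightarrow> 'a pair_pre_digraph \<Rightarrow> 'a pair_pre_digraph set" where
  "E_family A B = {add_edge (graph_union A B) a b | a b. a \<in> pverts A \<and> b \<in> pverts B}"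

end

theory Submission
  imports Defs
begin

text \<open>
  Let \<open>y\<close> be an eigenvector for \<open>\<lambda>\<^sub>2\<close> orthogonal to the positive Perron vector, and let \<open>P\<close>, \<open>N\<close> be
  the sets where \<open>y\<close> is positive and negative. Testing with \<open>y\<close> shows that the spectral radius of
  \<open>G[P]\<close>, and of each of its components, is at least \<open>\<lambda>\<^sub>2\<close>, and strictly larger if there are edges
  between \<open>P\<close> and \<open>N\<close>. Conversely, since a bridge creates no \<open>K\<^sub>r\<close> minor for \<open>r \<ge> 3\<close>, two copies of a
  \<open>K\<^sub>r\<close>-minor-free graph \<open>H\<close> can be connected through a new vertex or by an edge, which gives candidates
  with \<open>\<lambda>\<^sub>2\<close> at least, respectively almost, the spectral radius of \<open>H\<close>. If \<open>P\<close> had fewer than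
  \<open>\<lfloor>n/2\<rfloor>\<close> vertices, a pendant vertex attached to \<open>G[P]\<close> would give a strictly better candidate; hence
  \<open>P\<close> and \<open>N\<close> both have at least \<open>\<lfloor>n/2\<rfloor>\<close> vertices. For odd \<open>n\<close> this forces one further vertex, no edges between \<open>P\<close> and \<open>N\<close>, and
  extremal halves. For even \<open>n\<close> the quadratic form on the span of the two parts of \<open>y\<close> shows that
  deleting all but one of the edges between \<open>P\<close> and \<open>N\<close>, or adding an edge inside \<open>P\<close> or \<open>N\<close>,
  would increase \<open>\<lambda>\<^sub>2\<close>. The argument works for all \<open>n \<ge> 2\<close> and does not use the structure of the
  extremal graphs for the spectral radius.
\<close>

section \<open>Orthonormal eigenbases of adjacency matrices\<close>

text \<open>Over the complex numbers an eigenvalue exists. Symmetry makes the Hermitian form at its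
  eigenvector real, hence the eigenvalue is real; as a root of the real characteristic polynomial it
  also has a real eigenvector.\<close>

lemma real_symmetric_has_eigenvector:
  fixes A :: "real mat"
  assumes A: "A \<in> carrier_mat n n" and sym: "transpose_mat A = A" and n: "n > 0"
  shows "\<exists>v e. eigenvector A v e"
proof -
  let ?C = "map_mat complex_of_real A"
  have C: "?C \<in> carrier_mat n n" using A by auto
  from spectrum_non_empty[OF C n] obtain l where l: "eigenvalue ?C l" by (auto simp: spectrum_def)
  then obtain v where "eigenvector ?C v l" by (auto simp: eigenvalue_def)
  then have v: "v \<in> carrier_vec n" "v \<noteq> 0\<^sub>v n" and ev: "?C *\<^sub>v v = l \<cdot>\<^sub>v v"
    using A by (auto simp: eigenvector_def)
  have Aij: "A $$ (i,j) = A $$ (j,i)" if "i < n" "j < n" for i j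
    using arg_cong[OF sym, of "\<lambda>M. M $$ (i,j)"] A that by auto
  have evi: "(\<Sum>j<n. complex_of_real (A $$ (i,j)) * v $ j) = l * v $ i" if "i < n" for i
    using arg_cong[OF ev, of "\<lambda>w. w $ i"] that v A
    by (simp add: scalar_prod_def lessThan_atLeast0)
  have "(\<Sum>i<n. cnj (v $ i) * (\<Sum>j<n. complex_of_real (A $$ (i,j)) * v $ j)) = l * (\<Sum>i<n. cnj (v $ i) * v $ i)"
    unfolding sum_distrib_left[of l] by (intro sum.cong refl) (simp add: evi del: of_real_mult)
  then have 1: "(\<Sum>i<n. \<Sum>j<n. complex_of_real (A $$ (i,j)) * cnj (v $ i) * v $ j) = l * (\<Sum>i<n. cnj (v $ i) * v $ i)"
    unfolding sum_distrib_left by (simp add: mult_ac)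
  \<comment> \<open>Conjugation amounts to exchanging \<open>i\<close> and \<open>j\<close>, and
    \<open>Aij\<close> undoes the exchange. So the form, which is \<open>l\<close> times a squared
    norm, is real.\<close>
  have "cnj (\<Sum>i<n. \<Sum>j<n. complex_of_real (A $$ (i,j)) * cnj (v $ i) * v $ j) 
     = (\<Sum>i<n. \<Sum>j<n. complex_of_real (A $$ (i,j)) * (v $ i) * cnj (v $ j))" by simp
  also have "\<dots> = (\<Sum>j<n. \<Sum>i<n. complex_of_real (A $$ (i,j)) * (v $ i) * cnj (v $ j))"
    by (rule sum.swap)
  also have "\<dots> = (\<Sum>i<n. \<Sum>j<n. complex_of_real (A $$ (i,j)) * cnj (v $ i) * v $ j)"
    by (intro sum.cong refl) (simp add: Aij mult_ac)
  finally have "cnj l * cnj (\<Sum>i<n. cnj (v $ i) * v $ i) = l * (\<Sum>i<n. cnj (v $ i) * v $ i)"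
    unfolding 1 by simp
  moreover have "cnj (\<Sum>i<n. cnj (v $ i) * v $ i) = (\<Sum>i<n. cnj (v $ i) * v $ i)"
    by (simp add: mult_ac)
  moreover have "(\<Sum>i<n. cnj (v $ i) * v $ i) \<noteq> 0"
  proof
    assume z: "(\<Sum>i<n. cnj (v $ i) * v $ i) = 0"
    have "(\<Sum>i<n. cnj (v $ i) * v $ i) = complex_of_real (\<Sum>i<n. (cmod (v $ i))\<^sup>2)"
      unfolding of_real_sum by (intro sum.cong refl) (metis complex_norm_square mult.commute of_real_power)
    with z have "(\<Sum>i<n. (cmod (v $ i))\<^sup>2) = 0" by (metis of_real_eq_0_iff)
    then have "\<forall>i<n. v $ i = 0" by (simp add: sum_nonneg_eq_0_iff)
    then have "v = 0\<^sub>v n" using v by (intro eq_vecI) auto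
    with v show False by simp
  qed
  ultimately have "cnj l = l" by simp
  then obtain e where e: "l = complex_of_real e" by (metis Reals_cases Reals_cnj_iff)
  have "poly (char_poly ?C) l = 0" using l eigenvalue_root_char_poly[OF C] by simp
  then have "poly (char_poly A) e = 0"
    unfolding of_real_hom.char_poly_hom[OF A] e by (simp add: of_real_hom.poly_map_poly)
  then show ?thesis using eigenvalue_root_char_poly[OF A, of e] by (auto simp: eigenvalue_def)
qed

text \<open>Gram-Schmidt applied to a basis starting with \<open>v\<close> keeps its first vector,
  so after normalisation the first column is a multiple of \<open>v\<close>.\<close>

lemma orthonormal_mat_with_first_col:
  fixes v :: "real vec"
  assumes v: "v \<in> carrier_vec n" "v \<noteq> 0\<^sub>v n" and n: "n > 0"
  shows "\<exists>W \<in> carrier_mat n n. transpose_mat W * W = 1\<^sub>m n \<and> (\<exists>c. col W 0 = c \<cdot>\<^sub>v v)"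
proof -
  interpret cof_vec_space n "TYPE(real)" .
  let ?b = "basis_completion v"
  define ws where "ws = gram_schmidt n ?b"
  note b = basis_completion[OF v]
  from b(6,7) n obtain vs where bv: "?b = v # vs" by (cases ?b) auto
  from gram_schmidt_result[OF b(2,4,5) refl, folded ws_def]
  have ws: "set ws \<subseteq> carrier_vec n" "corthogonal ws" "length ws = n" using b by auto
  from gram_schmidt_hd[OF v(1), of vs, folded bv] have hd: "hd ws = v" unfolding ws_def .
  define us where "us = map (\<lambda>w. (1 / sqrt (w \<bullet> w)) \<cdot>\<^sub>v w) ws"
  define W where "W = mat_of_cols n us"
  have us: "us ! i \<in> carrier_vec n" "us ! i = (1 / sqrt (ws ! i \<bullet> ws ! i)) \<cdot>\<^sub>v ws ! i" 
      "ws ! i \<in> carrier_vec n" if "i < n" for i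
    using ws that by (auto simp: us_def)
  have W: "W \<in> carrier_mat n n" and col: "\<And>i. i < n \<Longrightarrow> col W i = us ! i"
    using ws us by (auto simp: W_def us_def)
  have conj: "conjugate w = w" for w :: "real vec" by (rule eq_vecI) auto
  have orth: "(ws ! i \<bullet> ws ! j = 0) = (i \<noteq> j)" if "i < n" "j < n" for i j
    using corthogonalD[OF ws(2), of i j] ws(3) that by (simp add: conj)
  have pos: "ws ! i \<bullet> ws ! i > 0" if "i < n" for i
  proof -
    have "ws ! i \<bullet> ws ! i \<ge> 0" by (simp add: scalar_prod_def sum_nonneg)
    with orth[OF that that] show ?thesis by linarith
  qed
  have "transpose_mat W * W = 1\<^sub>m n"
  proof (rule eq_matI)
    fix i j assume "i < dim_row (1\<^sub>m n :: real mat)" "j < dim_col (1\<^sub>m n :: real mat)"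
    then have i: "i < n" and j: "j < n" by auto
    have "(transpose_mat W * W) $$ (i,j) = us ! i \<bullet> us ! j" using W i j by (simp add: col)
    also have "\<dots> = (ws ! i \<bullet> ws ! j) / (sqrt (ws ! i \<bullet> ws ! i) * sqrt (ws ! j \<bullet> ws ! j))"
      using us(3)[OF i] us(3)[OF j] by (simp add: us(2)[OF i] us(2)[OF j])
    also have "\<dots> = 1\<^sub>m n $$ (i,j)" using orth[OF i j] pos[OF i] i j by auto
    finally show "(transpose_mat W * W) $$ (i,j) = 1\<^sub>m n $$ (i,j)" .
  qed (use W in auto)
  moreover have "col W 0 = (1 / sqrt (v \<bullet> v)) \<cdot>\<^sub>v v"
    using col[OF n] us(2)[OF n] hd ws(3) n by (metis hd_conv_nth length_greater_0_conv)
  ultimately show ?thesis using W by blast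
qed

text \<open>Deflation: in an orthonormal basis whose first vector is an eigenvector, the matrix
  splits into a 1 x 1 block and a symmetric block of size \<open>m\<close>, to which the induction
  hypothesis applies.\<close>

theorem real_symmetric_diagonalization:
  fixes A :: "real mat"
  assumes "A \<in> carrier_mat n n" "transpose_mat A = A"
  shows "\<exists>U \<in> carrier_mat n n. transpose_mat U * U = 1\<^sub>m n \<and>
    (\<exists>d. transpose_mat U * A * U = mat n n (\<lambda>(i, j). if i = j then d i else 0))"
  using assms
proof (induction n arbitrary: A)
  case 0
  show ?case by (rule bexI[of _ "1\<^sub>m 0"]) (use 0 in \<open>auto intro!: eq_matI\<close>)
next
  case (Suc m)
  let ?n = "Suc m"
  have A: "A \<in> carrier_mat ?n ?n" by fact
  from real_symmetric_has_eigenvector[OF Suc.prems] obtain v e where "eigenvector A v e" by auto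
  then have v: "v \<in> carrier_vec ?n" "v \<noteq> 0\<^sub>v ?n" and ev: "A *\<^sub>v v = e \<cdot>\<^sub>v v"
    using A by (auto simp: eigenvector_def)
  from orthonormal_mat_with_first_col[OF v] obtain W c where
    W: "W \<in> carrier_mat ?n ?n" and WW: "transpose_mat W * W = 1\<^sub>m ?n" and W0: "col W 0 = c \<cdot>\<^sub>v v" by auto
  define A' where "A' = transpose_mat W * A * W"
  have A': "A' \<in> carrier_mat ?n ?n" using W A by (auto simp: A'_def)
  have symA': "transpose_mat A' = A'" 
    unfolding A'_def using W A Suc.prems(2)
    by (simp add: transpose_mult[of _ ?n ?n _ ?n] assoc_mult_mat[of _ ?n ?n _ ?n _ ?n])
  \<comment> \<open>The first column of \<open>A * W\<close> is \<open>e\<close> times the first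
    column of \<open>W\<close>, so orthonormality leaves \<open>e\<close> in the corner and zeros
    below; symmetry then clears the first row.\<close>
  have A'0: "A' $$ (i, 0) = (if i = 0 then e else 0)" if i: "i < ?n" for i
  proof -
    have "A' = transpose_mat W * (A * W)" unfolding A'_def using W A by (simp add: assoc_mult_mat[of _ ?n ?n _ ?n _ ?n])
    then have "A' $$ (i, 0) = row (transpose_mat W) i \<bullet> col (A * W) 0" using W A i by simp
    also have "col (A * W) 0 = A *\<^sub>v col W 0" by (rule col_mult2[OF A W]) simp
    also have "row (transpose_mat W) i = col W i" using W i by simp
    also have "A *\<^sub>v col W 0 = e \<cdot>\<^sub>v col W 0" unfolding W0 using A v ev
      by (simp add: mult_mat_vec smult_smult_assoc mult.commute)
    also have "col W i \<bullet> (e \<cdot>\<^sub>v col W 0) = e * (transpose_mat W * W) $$ (i,0)" using W i by simp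
    finally show ?thesis unfolding WW using i by simp
  qed
  have A'0': "A' $$ (0, i) = (if i = 0 then e else 0)" if i: "i < ?n" for i
    using A'0[OF i] arg_cong[OF symA', of "\<lambda>M. M $$ (0, i)"] A' i by simp
  define B where "B = mat m m (\<lambda>(i,j). A' $$ (Suc i, Suc j))"
  have B: "B \<in> carrier_mat m m" by (simp add: B_def)
  have "transpose_mat B = B" 
  proof (rule eq_matI)
    fix i j assume "i < dim_row B" "j < dim_col B"
    then show "transpose_mat B $$ (i, j) = B $$ (i, j)"
      using arg_cong[OF symA', of "\<lambda>M. M $$ (Suc i, Suc j)"] A' by (simp add: B_def)
  qed (simp_all add: B_def)
  from Suc.IH[OF B this] obtain V d where V: "V \<in> carrier_mat m m" and VV: "transpose_mat V * V = 1\<^sub>m m"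
    and Vd: "transpose_mat V * B * V = mat m m (\<lambda>(i, j). if i = j then d i else 0)" by auto
  have A'block: "A' = four_block_mat (mat 1 1 (\<lambda>_. e)) (0\<^sub>m 1 m) (0\<^sub>m m 1) B"
    by (rule eq_matI) (use A' A'0 A'0' in \<open>auto simp: B_def\<close>)
  define X where "X = four_block_mat (1\<^sub>m 1) (0\<^sub>m 1 m) (0\<^sub>m m 1) V"
  have X: "X \<in> carrier_mat ?n ?n" using V by (auto simp: X_def)
  have XT: "transpose_mat X = four_block_mat (1\<^sub>m 1) (0\<^sub>m 1 m) (0\<^sub>m m 1) (transpose_mat V)"
    unfolding X_def using V by (subst transpose_four_block_mat[of _ 1 1 _ m _ m]) auto
  have XX: "transpose_mat X * X = 1\<^sub>m ?n"
    unfolding XT unfolding X_def using V VV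
    by (subst mult_four_block_mat[of _ 1 1 _ m _ m]) (auto simp: intro!: eq_matI)
  define D where "D = transpose_mat V * B * V"
  have XAX: "transpose_mat X * A' * X = four_block_mat (mat 1 1 (\<lambda>_. e)) (0\<^sub>m 1 m) (0\<^sub>m m 1) D"
    unfolding XT unfolding X_def A'block D_def using V B
    by (simp add: mult_four_block_mat[of _ 1 1 _ m _ m _ _ 1 _ m])
  \<comment> \<open>\<open>W\<close> splits off the eigenvector and \<open>X\<close> diagonalises
    the remaining block.\<close>
  define U where "U = W * X"
  have U: "U \<in> carrier_mat ?n ?n" using W X by (simp add: U_def)
  have "transpose_mat U * U = transpose_mat X * (transpose_mat W * W) * X"
    unfolding U_def using W X by (simp add: transpose_mult[of _ ?n ?n _ ?n] assoc_mult_mat[of _ ?n ?n _ ?n _ ?n])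
  then have UU: "transpose_mat U * U = 1\<^sub>m ?n" using X by (simp add: WW XX)
  have "transpose_mat U * A * U = transpose_mat X * A' * X"
    unfolding U_def A'_def using W X A by (simp add: transpose_mult[of _ ?n ?n _ ?n] assoc_mult_mat[of _ ?n ?n _ ?n _ ?n])
  also have "\<dots> = mat ?n ?n (\<lambda>(i, j). if i = j then (case i of 0 \<Rightarrow> e | Suc k \<Rightarrow> d k) else 0)"
    unfolding XAX D_def Vd by (rule eq_matI) (auto split: nat.splits)
  finally show ?case using U UU by blast
qed

text \<open>A left inverse of a square matrix is also a right inverse. Hence \<open>A\<close> is
  similar to the diagonal matrix and shares its characteristic polynomial.\<close>

lemma char_poly_orthogonally_diagonal:
  fixes A :: "real mat"
  assumes A: "A \<in> carrier_mat n n" and U: "U \<in> carrier_mat n n" and UU: "transpose_mat U * U = 1\<^sub>m n"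
    and D: "transpose_mat U * A * U = mat n n (\<lambda>(i, j). if i = j then d i else 0)" (is "_ = ?D")
  shows "char_poly A = (\<Prod>i\<leftarrow>[0..<n]. [:- d i, 1:])"
    and "U * transpose_mat U = 1\<^sub>m n"
    and "A * U = U * mat n n (\<lambda>(i, j). if i = j then d i else 0)"
proof -
  have UT: "transpose_mat U \<in> carrier_mat n n" using U by simp
  show UU': "U * transpose_mat U = 1\<^sub>m n" by (rule mat_mult_left_right_inverse[OF UT U UU])
  have "U * ?D = (U * transpose_mat U) * A * U" unfolding D[symmetric]
    using U A UT by (simp add: assoc_mult_mat[of _ n n _ n _ n])
  then show AU: "A * U = U * ?D" using A by (simp add: UU')
  have "U * ?D * transpose_mat U = A * (U * transpose_mat U)" unfolding AU[symmetric]
    using U A UT by (simp add: assoc_mult_mat[of _ n n _ n _ n])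
  then have "A = U * ?D * transpose_mat U" using A by (simp add: UU')
  then have "similar_mat_wit A ?D U (transpose_mat U)"
    by (intro similar_mat_witI[of _ _ n]) (use U UT A UU UU' in auto)
  then have "similar_mat A ?D" unfolding similar_mat_def by blast
  then have "char_poly A = char_poly ?D" by (rule char_poly_similar)
  also have "\<dots> = (\<Prod>a\<leftarrow>diag_mat ?D. [:- a, 1:])"
    by (rule char_poly_upper_triangular[of _ n]) auto
  also have "diag_mat ?D = map d [0..<n]" by (auto simp: diag_mat_def)
  finally show "char_poly A = (\<Prod>i\<leftarrow>[0..<n]. [:- d i, 1:])" by (simp add: o_def)
qed

lemma proots_prod_linear_factors: "proots (\<Prod>a\<leftarrow>xs. [:- a, 1:]) = mset (xs :: real list)"
proof (induction xs)
  case (Cons a xs)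
  have "(\<Prod>a\<leftarrow>xs. [:- a, 1:]) \<noteq> 0" by (auto simp: prod_list_zero_iff)
  then have "proots ([:- a, 1:] * (\<Prod>a\<leftarrow>xs. [:- a, 1:])) = proots [:- a, 1:] + proots (\<Prod>a\<leftarrow>xs. [:- a, 1:])"
    by (intro proots_mult) auto
  then show ?case using Cons.IH by simp
qed simp

section \<open>Eigenbases indexed by vertices\<close>

text \<open>Eigenvectors are functions on vertices, which hides matrices and the vertex order from
  everything that follows. \<open>complete\<close> is the orthonormality of the rows of the
  eigenvector matrix; \<open>radius\<close> takes absolute values because a negative eigenvalue may
  a priori have the largest modulus.\<close>

locale adjacency_eigenbasis = pair_graph G for G :: "'a::linorder pair_pre_digraph" +
  fixes d :: "nat \<Rightarrow> real" and e :: "nat \<Rightarrow> 'a \<Rightarrow> real"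
  assumes orthonormal: "\<And>i j. i < card (pverts G) \<Longrightarrow> j < card (pverts G) \<Longrightarrow>
      (\<Sum>u\<in>pverts G. e i u * e j u) = (if i = j then 1 else 0)"
    and complete: "\<And>u v. u \<in> pverts G \<Longrightarrow> v \<in> pverts G \<Longrightarrow>
      (\<Sum>i<card (pverts G). e i u * e i v) = (if u = v then 1 else 0)"
    and eigen: "\<And>i u. i < card (pverts G) \<Longrightarrow> u \<in> pverts G \<Longrightarrow>
      (\<Sum>v | (u, v) \<in> parcs G. e i v) = d i * e i u"
    and decreasing: "\<And>i j. i \<le> j \<Longrightarrow> j < card (pverts G) \<Longrightarrow> d j \<le> d i"
    and eigenvalues: "graph_eigenvalues G = map d [0..<card (pverts G)]"
    and radius: "graph_spectral_radius G = Max ((\<lambda>i. \<bar>d i\<bar>) ` {..<card (pverts G)})"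

text \<open>The entries of the diagonalising matrix are read off with rows indexed by vertices
  through \<open>idx\<close> and columns rearranged by \<open>p\<close>.\<close>

lemma adjacency_eigenbasis_exists:
  fixes G :: "'a::linorder pair_pre_digraph"
  assumes "pair_graph G"
  shows "\<exists>d e. adjacency_eigenbasis G d e"
proof -
  interpret pair_graph G by fact
  define vs where "vs = sorted_list_of_set (pverts G)"
  define n where "n = card (pverts G)"
  have vs: "set vs = pverts G" "distinct vs" "length vs = n"
    using pair_finite_verts by (auto simp: vs_def n_def)
  define idx where "idx = inv_into {..<n} ((!) vs)"
  have bij: "bij_betw ((!) vs) {..<n} (pverts G)"
    using vs bij_betw_nth[of vs "{..<n}" "pverts G"] by auto
  then have idx: "bij_betw idx (pverts G) {..<n}"
    unfolding idx_def by (rule bij_betw_inv_into)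
  have idx_lt: "idx u < n" and vs_idx: "vs ! idx u = u" if "u \<in> pverts G" for u
    using bij_betwE[OF idx] that bij_betw_inv_into_right[OF bij that] by (auto simp: idx_def)
  have sum_idx: "(\<Sum>u\<in>pverts G. f (idx u)) = (\<Sum>k<n. f k)" for f :: "nat \<Rightarrow> real"
    by (rule sum.reindex_bij_betw[OF idx])
  define A :: "real mat" where "A = adjacency_mat G"
  have A: "A \<in> carrier_mat n n" and Aij: "\<And>i j. i < n \<Longrightarrow> j < n \<Longrightarrow> A $$ (i,j) = (if (vs ! i, vs ! j) \<in> parcs G then 1 else 0)"
    using vs by (auto simp: A_def adjacency_mat_def Let_def vs_def[symmetric])
  have "transpose_mat A = A"
    by (rule eq_matI) (use A Aij arcs_symmetric in auto)
  from real_symmetric_diagonalization[OF A this] obtain U d0 where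
    U: "U \<in> carrier_mat n n" and UU: "transpose_mat U * U = 1\<^sub>m n"
    and D: "transpose_mat U * A * U = mat n n (\<lambda>(i, j). if i = j then d0 i else 0)" by auto
  note diag = char_poly_orthogonally_diagonal[OF A U UU D]
  define es where "es = rev (sort (map d0 [0..<n]))"
  have ge: "graph_eigenvalues G = es"
    unfolding graph_eigenvalues_def A_def[symmetric] diag(1) es_def
    using proots_prod_linear_factors[of "map d0 [0..<n]"] by (simp add: o_def flip: sorted_list_of_multiset_mset)
  have "mset es = mset (map d0 [0..<n])" by (simp add: es_def)
  \<comment> \<open>The diagonalisation yields the eigenvalues in no particular order;
    \<open>p\<close> brings them into the order of \<open>graph_eigenvalues\<close>.\<close>
  then obtain p where p: "p permutes {..<n}" and pes: "permute_list p (map d0 [0..<n]) = es"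
    using mset_eq_permutation[of es "map d0 [0..<n]"] by (metis length_map length_upt diff_zero)
  have plt: "p i < n" if "i < n" for i using permutes_in_image[OF p] that by auto
  have es_nth: "es ! i = d0 (p i)" if "i < n" for i
    using that plt[OF that] p unfolding pes[symmetric] by (simp add: permute_list_nth)
  have len: "length es = n" by (simp add: es_def)
  define d where "d i = es ! i" for i
  define e where "e i u = U $$ (idx u, p i)" for i u
  have orthonormal: "(\<Sum>u\<in>pverts G. e i u * e j u) = (if i = j then 1 else 0)" if ij: "i < n" "j < n" for i j
  proof -
    have "(\<Sum>u\<in>pverts G. e i u * e j u) = (\<Sum>k<n. U $$ (k, p i) * U $$ (k, p j))"
      unfolding e_def by (rule sum_idx)
    also have "\<dots> = (transpose_mat U * U) $$ (p i, p j)"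
      using U ij plt by (simp add: scalar_prod_def lessThan_atLeast0)
    also have "\<dots> = (if p i = p j then 1 else 0)" unfolding UU using ij plt by simp
    also have "p i = p j \<longleftrightarrow> i = j" using permutes_inj[OF p] by (auto dest: injD)
    finally show ?thesis .
  qed
  have complete: "(\<Sum>i<n. e i u * e i v) = (if u = v then 1 else 0)" if uv: "u \<in> pverts G" "v \<in> pverts G" for u v
  proof -
    have "(\<Sum>i<n. e i u * e i v) = (\<Sum>k<n. U $$ (idx u, k) * U $$ (idx v, k))"
      unfolding e_def by (rule sum.reindex_bij_betw[OF permutes_imp_bij[OF p]])
    also have "\<dots> = (U * transpose_mat U) $$ (idx u, idx v)"
      using U idx_lt uv by (simp add: scalar_prod_def lessThan_atLeast0)
    also have "\<dots> = (if idx u = idx v then 1 else 0)" unfolding diag(2) using idx_lt uv by simp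
    also have "idx u = idx v \<longleftrightarrow> u = v" using vs_idx uv by metis
    finally show ?thesis .
  qed
  have eigen: "(\<Sum>v | (u, v) \<in> parcs G. e i v) = d i * e i u" if iu: "i < n" "u \<in> pverts G" for i u
  proof -
    have "(\<Sum>v | (u, v) \<in> parcs G. e i v) = (\<Sum>v\<in>pverts G. if (u, v) \<in> parcs G then e i v else 0)"
      by (rule sum.mono_neutral_cong_left) (use pair_finite_verts in_arcsD2 in auto)
    also have "\<dots> = (\<Sum>v\<in>pverts G. A $$ (idx u, idx v) * U $$ (idx v, p i))"
      by (intro sum.cong refl) (use iu idx_lt vs_idx in \<open>auto simp: Aij e_def\<close>)
    also have "\<dots> = (\<Sum>k<n. A $$ (idx u, k) * U $$ (k, p i))" by (rule sum_idx)
    also have "\<dots> = (A * U) $$ (idx u, p i)"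
      using A U iu idx_lt plt by (simp add: scalar_prod_def lessThan_atLeast0)
    also have "\<dots> = (\<Sum>k<n. U $$ (idx u, k) * (if k = p i then d0 k else 0))"
      unfolding diag(3) using A U iu idx_lt plt by (simp add: scalar_prod_def lessThan_atLeast0)
    also have "\<dots> = d i * e i u"
      using plt iu by (simp add: if_distrib cong: if_cong) (simp add: d_def e_def es_nth)
    finally show ?thesis .
  qed
  have decreasing: "d j \<le> d i" if "i \<le> j" "j < n" for i j
  proof -
    have "sorted (rev es)" by (simp add: es_def)
    then show ?thesis using sorted_rev_nth_mono[of es i j] that len by (simp add: d_def)
  qed
  have radius: "graph_spectral_radius G = Max ((\<lambda>i. \<bar>d i\<bar>) ` {..<n})"
  proof -
    \<comment> \<open>\<open>adjacency_mat\<close> is polymorphic: the complex instance behind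
      \<open>graph_spectral_radius\<close> is the image of the real matrix \<open>A\<close>, so its
      spectrum consists of the same numbers \<open>d0 i\<close>.\<close>
    have AC: "adjacency_mat G = map_mat complex_of_real A"
      by (rule eq_matI) (auto simp: A_def adjacency_mat_def Let_def)
    interpret mp: map_poly_comm_ring_hom complex_of_real ..
    have "char_poly (map_mat complex_of_real A) = (\<Prod>i\<leftarrow>[0..<n]. [:- complex_of_real (d0 i), 1:])"
      unfolding of_real_hom.char_poly_hom[OF A] diag(1) by (simp add: mp.hom_prod_list o_def)
    then have "spectrum (map_mat complex_of_real A) = (\<lambda>i. complex_of_real (d0 i)) ` {..<n}"
      using spectrum_root_char_poly[of "map_mat complex_of_real A" n] A
      by (auto simp: poly_prod_list prod_list_zero_iff o_def)
    also have "\<dots> = (\<lambda>i. complex_of_real (d0 i)) ` p ` {..<n}" using permutes_image[OF p] by simp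
    finally have "norm ` spectrum (map_mat complex_of_real A) = (\<lambda>i. \<bar>d i\<bar>) ` {..<n}"
      by (auto simp: image_iff d_def es_nth)
    then show ?thesis by (simp add: graph_spectral_radius_def spectral_radius_def AC)
  qed
  have "graph_eigenvalues G = map d [0..<n]"
    unfolding ge d_def by (rule nth_equalityI) (auto simp: len)
  then have "adjacency_eigenbasis G d e"
    by unfold_locales (use orthonormal complete eigen decreasing radius in \<open>auto simp: n_def\<close>)
  then show ?thesis by blast
qed

section \<open>Connectivity and complete minors\<close>

lemma pair_graph_iff:
  "pair_graph G \<longleftrightarrow> finite (pverts G) \<and> parcs G \<subseteq> pverts G \<times> pverts G \<and>
     sym (parcs G) \<and> (\<forall>u. (u, u) \<notin> parcs G)" (is "_ = ?R")
proof
  assume "pair_graph G"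
  then interpret pair_graph G .
  show ?R using pair_finite_verts in_arcsD1 in_arcsD2 no_loops' arcs_symmetric
    by (intro conjI allI notI symI subrelI) (blast+)
next
  assume R: ?R
  then have "finite (parcs G)" by (meson finite_SigmaI finite_subset)
  with R show "pair_graph G"
    by unfold_locales (auto simp: symmetric_def)
qed

text \<open>Connectedness by cuts instead of walks. Only arcs inside \<open>V\<close> matter, so
  \<open>cut_connected B (parcs G)\<close> speaks about the subgraph induced on \<open>B\<close>,
  and it is monotone in the arcs.\<close>

definition cut_connected :: "'a set \<Rightarrow> 'a rel \<Rightarrow> bool" where
  "cut_connected V R \<longleftrightarrow> V \<noteq> {} \<and> (\<forall>S. S \<subseteq> V \<and> S \<noteq> {} \<and> S \<noteq> V \<longrightarrow> R \<inter> S \<times> (V - S) \<noteq> {})"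

lemma cut_connectedD:
  assumes "cut_connected V R" "S \<subseteq> V" "S \<noteq> {}" "S \<noteq> V"
  obtains u v where "u \<in> S" "v \<in> V" "v \<notin> S" "(u, v) \<in> R"
  using assms unfolding cut_connected_def by blast

lemma cut_connected_mono: "cut_connected V R \<Longrightarrow> R \<subseteq> R' \<Longrightarrow> cut_connected V R'"
  unfolding cut_connected_def by blast

text \<open>A walk cannot leave a set that no arc leaves; conversely, no arc leaves the set of
  vertices reachable from \<open>u\<close>, so it is everything.\<close>

lemma connected_induce_iff:
  assumes "sym (parcs G)"
  shows "Digraph_Component.connected (with_proj G \<restriction> B) \<longleftrightarrow> cut_connected B (parcs G)"
proof -
  let ?M = "mk_symmetric (with_proj G \<restriction> B)"
  let ?R = "parcs G \<inter> B \<times> B"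
  have M: "pverts ?M = B" "parcs ?M = ?R"
    using assms by (auto simp: parcs_mk_symmetric dest: symD)
  have con: "Digraph_Component.connected (with_proj G \<restriction> B) \<longleftrightarrow>
      B \<noteq> {} \<and> (\<forall>u\<in>B. \<forall>v\<in>B. (u, v) \<in> rtrancl_on B ?R)"
    by (simp add: connected_def strongly_connected_def reachable_def M)
  show ?thesis
  proof
    assume L: "Digraph_Component.connected (with_proj G \<restriction> B)"
    have "parcs G \<inter> S \<times> (B - S) \<noteq> {}" if S: "S \<subseteq> B" "S \<noteq> {}" "S \<noteq> B" for S
    proof
      assume no: "parcs G \<inter> S \<times> (B - S) = {}"
      from S obtain u v where uv: "u \<in> S" "v \<in> B" "v \<notin> S" by auto
      then have "(u, v) \<in> rtrancl_on B ?R" using L con S by blast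
      then have "v \<in> S" by (induction rule: rtrancl_on_induct) (use uv no in auto)
      with uv show False by simp
    qed
    with L con show "cut_connected B (parcs G)" by (auto simp: cut_connected_def)
  next
    assume R: "cut_connected B (parcs G)"
    have "(u, v) \<in> rtrancl_on B ?R" if uv: "u \<in> B" "v \<in> B" for u v
    proof -
      let ?S = "{w. (u, w) \<in> rtrancl_on B ?R}"
      have sub: "?S \<subseteq> B" using in_rtrancl_on_in_F by fast
      have "?S = B"
      proof (rule ccontr)
        assume "?S \<noteq> B"
        then obtain a b where "a \<in> ?S" "b \<in> B" "b \<notin> ?S" "(a, b) \<in> parcs G"
          using cut_connectedD[OF R sub] uv by blast
        then show False using sub rtrancl_on_into_rtrancl_on[of u a B ?R b] by blast
      qed
      with uv show ?thesis by blast
    qed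
    with R con show "Digraph_Component.connected (with_proj G \<restriction> B)"
      by (auto simp: cut_connected_def)
  qed
qed

lemma connected_iff_cut:
  assumes "pair_graph G"
  shows "Digraph_Component.connected (with_proj G) \<longleftrightarrow> cut_connected (pverts G) (parcs G)"
proof -
  have "with_proj G \<restriction> pverts G = with_proj G"
    using assms by (auto simp: pair_graph_iff induce_subgraph_def with_proj_def)
  then show ?thesis
    using connected_induce_iff[of G "pverts G"] assms by (simp add: pair_graph_iff)
qed

section \<open>Complete minors as families of branch sets\<close>

text \<open>The branch sets of a complete minor, numbered from 0 to \<open>r - 1\<close>; this
  removes the auxiliary complete graph from the notion of a minor.\<close>

definition K_model :: "nat \<Rightarrow> 'a pair_pre_digraph \<Rightarrow> (nat \<Rightarrow> 'a set) \<Rightarrow> bool" where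
  "K_model r G B \<longleftrightarrow>
     (\<forall>i<r. B i \<subseteq> pverts G \<and> cut_connected (B i) (parcs G)) \<and>
     (\<forall>i<r. \<forall>j<r. i \<noteq> j \<longrightarrow> B i \<inter> B j = {} \<and> parcs G \<inter> B i \<times> B j \<noteq> {})"

text \<open>Branch sets are renumbered along a bijection from \<open>{..<r}\<close> to the vertices
  of the complete graph; for the converse, the complete graph on \<open>{..<r}\<close>
  serves.\<close>

lemma K_minor_free_iff:
  assumes "pair_graph G"
  shows "K_minor_free r G \<longleftrightarrow> (\<nexists>B. K_model r G B)"
proof -
  have s: "sym (parcs G)" using assms by (simp add: pair_graph_iff)
  have "(\<exists>K :: nat pair_pre_digraph. complete_digraph r (with_proj K) \<and> is_minor K G) \<longleftrightarrow> (\<exists>B. K_model r G B)"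
  proof
    assume "\<exists>K :: nat pair_pre_digraph. complete_digraph r (with_proj K) \<and> is_minor K G"
    then obtain K :: "nat pair_pre_digraph" and B where K: "finite (pverts K)" "card (pverts K) = r"
      "parcs K = {(u,v). (u,v) \<in> pverts K \<times> pverts K \<and> u \<noteq> v}"
      and B: "\<forall>x\<in>pverts K. B x \<subseteq> pverts G \<and> Digraph_Component.connected (with_proj G \<restriction> B x)"
        "\<forall>x\<in>pverts K. \<forall>y\<in>pverts K. x \<noteq> y \<longrightarrow> B x \<inter> B y = {}"
        "\<forall>(x, y)\<in>parcs K. \<exists>u\<in>B x. \<exists>v\<in>B y. (u, v) \<in> parcs G"
      unfolding complete_digraph_pair_def is_minor_def by blast
    from K(1,2) obtain f where f: "bij_betw f {..<r} (pverts K)"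
      using ex_bij_betw_nat_finite[OF K(1)] by (auto simp: lessThan_atLeast0)
    have fi: "f i \<in> pverts K" if "i < r" for i using bij_betwE[OF f] that by auto
    have fij: "f i \<noteq> f j" if "i < r" "j < r" "i \<noteq> j" for i j
      using bij_betw_imp_inj_on[OF f] that by (auto dest: inj_onD)
    have "K_model r G (B \<circ> f)"
      unfolding K_model_def
    proof (intro conjI allI impI)
      fix i assume "i < r"
      then show "(B \<circ> f) i \<subseteq> pverts G" "cut_connected ((B \<circ> f) i) (parcs G)"
        using B(1) fi by (auto simp: connected_induce_iff[OF s])
    next
      fix i j assume ij: "i < r" "j < r" "i \<noteq> j"
      then show "(B \<circ> f) i \<inter> (B \<circ> f) j = {}" using B(2) fi fij by auto
      have "(f i, f j) \<in> parcs K" using ij fi fij by (simp add: K(3))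
      then show "parcs G \<inter> (B \<circ> f) i \<times> (B \<circ> f) j \<noteq> {}" using B(3) by fastforce
    qed
    then show "\<exists>B. K_model r G B" by (rule exI[of "K_model r G"])
  next
    assume "\<exists>B. K_model r G B"
    then obtain B where B: "K_model r G B" ..
    define K :: "nat pair_pre_digraph" where
      "K = \<lparr>pverts = {..<r}, parcs = {(u, v). (u, v) \<in> {..<r} \<times> {..<r} \<and> u \<noteq> v}\<rparr>"
    have "complete_digraph r (with_proj K)" unfolding complete_digraph_pair_def by (simp add: K_def)
    moreover have "is_minor K G" unfolding is_minor_def
    proof (intro exI[of _ B] conjI ballI impI)
      fix x assume "x \<in> pverts K"
      then show "B x \<subseteq> pverts G" "Digraph_Component.connected (with_proj G \<restriction> B x)"
        using B by (auto simp: K_model_def K_def connected_induce_iff[OF s])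
    next
      fix x y assume "x \<in> pverts K" "y \<in> pverts K" "x \<noteq> y"
      then show "B x \<inter> B y = {}" using B by (auto simp: K_model_def K_def)
    next
      fix e assume "e \<in> parcs K"
      then obtain x y where "e = (x, y)" "x < r" "y < r" "x \<noteq> y" by (auto simp: K_def)
      moreover from this have "parcs G \<inter> B x \<times> B y \<noteq> {}" using B by (auto simp: K_model_def)
      ultimately show "case e of (x, y) \<Rightarrow> \<exists>u\<in>B x. \<exists>v\<in>B y. (u, v) \<in> parcs G" by auto
    qed
    ultimately show "\<exists>K :: nat pair_pre_digraph. complete_digraph r (with_proj K) \<and> is_minor K G" by blast
  qed
  then show ?thesis by (simp add: K_minor_free_def)
qed

lemma K_minor_free_mono:
  assumes "pair_graph G" "pair_graph H" "K_minor_free r G" "pverts H \<subseteq> pverts G" "parcs H \<subseteq> parcs G"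
  shows "K_minor_free r H"
proof -
  have "K_model r G B" if "K_model r H B" for B
    using that assms(4,5) cut_connected_mono[OF _ assms(5)] unfolding K_model_def by blast
  then show ?thesis using assms(1-3) by (auto simp: K_minor_free_iff)
qed

subsection \<open>Joining two graphs by a bridge\<close>

abbreviation bridge_join :: "'a pair_pre_digraph \<Rightarrow> 'a pair_pre_digraph \<Rightarrow> 'a \<Rightarrow> 'a \<Rightarrow> 'a pair_pre_digraph" where
  "bridge_join A B a b \<equiv> add_edge (graph_union A B) a b"

lemma bridge_join_simps:
  "pverts (bridge_join A B a b) = pverts A \<union> pverts B"
  "parcs (bridge_join A B a b) = parcs A \<union> parcs B \<union> {(a, b), (b, a)}"
  by (simp_all add: add_edge_def graph_union_def)

locale two_graphs =
  fixes A B :: "'a pair_pre_digraph" and a b :: 'a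
  assumes A: "pair_graph A" and B: "pair_graph B" and disj: "pverts A \<inter> pverts B = {}"
    and a: "a \<in> pverts A" and b: "b \<in> pverts B"
begin

lemma arcs_in: "parcs A \<subseteq> pverts A \<times> pverts A" "parcs B \<subseteq> pverts B \<times> pverts B"
  using A B by (auto simp: pair_graph_iff)

lemma pair_graph_bridge_join: "pair_graph (bridge_join A B a b)"
  using A B a b disj by (auto simp: pair_graph_iff bridge_join_simps sym_def)

lemma card_bridge_join: "card (pverts (bridge_join A B a b)) = card (pverts A) + card (pverts B)"
  using A B disj by (simp add: bridge_join_simps card_Un_disjoint pair_graph_iff)

text \<open>A cut that separates one of the sides is crossed inside that side; any other cut
  separates the two sides and is crossed by the bridge.\<close>

lemma cut_connected_bridge_join:
  assumes cA: "cut_connected (pverts A) (parcs A)" and cB: "cut_connected (pverts B) (parcs B)"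
  shows "cut_connected (pverts (bridge_join A B a b)) (parcs (bridge_join A B a b))"
  unfolding cut_connected_def bridge_join_simps
proof (intro conjI allI impI)
  show "pverts A \<union> pverts B \<noteq> {}" using a by auto
next
  fix S assume S: "S \<subseteq> pverts A \<union> pverts B \<and> S \<noteq> {} \<and> S \<noteq> pverts A \<union> pverts B"
  show "(parcs A \<union> parcs B \<union> {(a, b), (b, a)}) \<inter> S \<times> (pverts A \<union> pverts B - S) \<noteq> {}"
  proof (cases "S \<inter> pverts A \<noteq> {} \<and> S \<inter> pverts A \<noteq> pverts A")
    case True
    then show ?thesis using cut_connectedD[OF cA, of "S \<inter> pverts A"] by blast
  next
    case sA: False
    show ?thesis
    proof (cases "S \<inter> pverts B \<noteq> {} \<and> S \<inter> pverts B \<noteq> pverts B")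
      case True
      then show ?thesis using cut_connectedD[OF cB, of "S \<inter> pverts B"] by blast
    next
      case False
      \<comment> \<open>Here \<open>S\<close> is exactly one of the two sides.\<close>
      with sA S a b disj show ?thesis by blast
    qed
  qed
qed

lemma bridge_join_arcD:
  assumes "(u, v) \<in> parcs (bridge_join A B a b)"
  shows "u \<in> pverts A \<Longrightarrow> (u, v) \<in> parcs A \<or> u = a \<and> v = b"
    and "u \<in> pverts B \<Longrightarrow> (u, v) \<in> parcs B \<or> u = b \<and> v = a"
  using assms arcs_in disj a b unfolding bridge_join_simps by blast+

text \<open>The bridge is the only edge between the sides, so a connected set meeting both must
  contain its two ends.\<close>

lemma bridge_ends_in_connected:
  assumes "cut_connected M (parcs (bridge_join A B a b))" "M \<subseteq> pverts A \<union> pverts B"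
    and "M \<inter> pverts A \<noteq> {}" "M \<inter> pverts B \<noteq> {}"
  shows "a \<in> M" "b \<in> M"
proof -
  have "M \<inter> pverts A \<noteq> M" using assms disj by blast
  then obtain u v where uv: "u \<in> M \<inter> pverts A" "v \<in> M" "v \<notin> M \<inter> pverts A"
    "(u, v) \<in> parcs (bridge_join A B a b)"
    using cut_connectedD[OF assms(1), of "M \<inter> pverts A"] assms(3) by blast
  then have "v \<notin> pverts A" by blast
  then have "(u, v) \<notin> parcs A" using arcs_in by blast
  then have "u = a \<and> v = b" using bridge_join_arcD(1)[OF uv(4)] uv(1) by blast
  with uv show "a \<in> M" "b \<in> M" by auto
qed

text \<open>A branch set reaching into \<open>B\<close> contains \<open>a\<close>, and by
  disjointness at most one does. Its part in \<open>B\<close> hangs on \<open>a\<close> alone, so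
  cutting it off destroys neither connectedness nor an adjacency with another branch set.\<close>

lemma K_model_restrict_to_side:
  assumes M: "K_model r (bridge_join A B a b) M" and meet: "\<forall>i<r. M i \<inter> pverts A \<noteq> {}"
  shows "K_model r A (\<lambda>i. M i \<inter> pverts A)"
proof -
  let ?G = "bridge_join A B a b"
  have sub: "M i \<subseteq> pverts A \<union> pverts B" and con: "cut_connected (M i) (parcs ?G)" if "i < r" for i
    using M that by (auto simp: K_model_def bridge_join_simps)
  have dis: "M i \<inter> M j = {}" and adj: "parcs ?G \<inter> M i \<times> M j \<noteq> {}" if "i < r" "j < r" "i \<noteq> j" for i j
    using M that by (auto simp: K_model_def)
  have aM: "a \<in> M i" if i: "i < r" "M i \<inter> pverts B \<noteq> {}" for i
    using bridge_ends_in_connected[OF con[OF i(1)] sub[OF i(1)]] meet i by blast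
  have "cut_connected (M i \<inter> pverts A) (parcs A)" if i: "i < r" for i
    unfolding cut_connected_def
  proof (intro conjI allI impI)
    let ?N = "M i \<inter> pverts A"
    show "?N \<noteq> {}" using meet i by simp
    fix S assume S: "S \<subseteq> ?N \<and> S \<noteq> {} \<and> S \<noteq> ?N"
    \<comment> \<open>An arc leaving \<open>T\<close> cannot be the bridge when \<open>a\<close> is
      outside \<open>T\<close>, so it stays in \<open>A\<close>. A set containing \<open>a\<close>
      is handled through its complement and symmetry.\<close>
    have cross: "\<exists>u v. u \<in> T \<and> v \<in> ?N - T \<and> (u, v) \<in> parcs A"
      if T: "T \<subseteq> ?N" "T \<noteq> {}" "a \<notin> T" "T \<noteq> ?N" for T
    proof -
      have T': "T \<subseteq> M i" "T \<noteq> M i" using T by auto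
      obtain u v where uv: "u \<in> T" "v \<in> M i" "v \<notin> T" "(u, v) \<in> parcs ?G"
        using cut_connectedD[OF con[OF i] T'(1) T(2) T'(2)] by blast
      have "u \<in> pverts A" "u \<noteq> a" using uv T by auto
      then have "(u, v) \<in> parcs A" using bridge_join_arcD(1)[OF uv(4)] by blast
      then show ?thesis using uv arcs_in by blast
    qed
    show "parcs A \<inter> S \<times> (?N - S) \<noteq> {}"
    proof (cases "a \<in> S")
      case False
      then obtain u v where "u \<in> S" "v \<in> ?N - S" "(u, v) \<in> parcs A" using cross[of S] S by blast
      then show ?thesis by blast
    next
      case True
      then obtain u v where uv: "u \<in> ?N - S" "v \<in> ?N - (?N - S)" "(u, v) \<in> parcs A"
        using cross[of "?N - S"] S by blast
      then have "(v, u) \<in> parcs A" using A by (auto simp: pair_graph_iff dest: symD)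
      with uv show ?thesis by blast
    qed
  qed
  moreover have "parcs A \<inter> (M i \<inter> pverts A) \<times> (M j \<inter> pverts A) \<noteq> {}" if ij: "i < r" "j < r" "i \<noteq> j" for i j
  proof -
    obtain u v where uv: "u \<in> M i" "v \<in> M j" "(u, v) \<in> parcs ?G" using adj[OF ij] by blast
    have not_both: "\<not> (a \<in> M i \<and> a \<in> M j)" using dis[OF ij] by blast
    have "u \<in> pverts A"
    proof (rule ccontr)
      assume "u \<notin> pverts A"
      with uv sub[OF ij(1)] have uB: "u \<in> pverts B" by blast
      with uv have ai: "a \<in> M i" using aM[OF ij(1)] by blast
      from bridge_join_arcD(2)[OF uv(3) uB] show False
      proof
        assume "(u, v) \<in> parcs B"
        then have "a \<in> M j" using aM[OF ij(2)] uv arcs_in by blast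
        with ai not_both show False by blast
      qed (use ai uv not_both in blast)
    qed
    moreover have "(u, v) \<in> parcs A"
      using bridge_join_arcD(1)[OF uv(3) \<open>u \<in> pverts A\<close>]
    proof
      assume "u = a \<and> v = b"
      with uv b have "a \<in> M i" "a \<in> M j" using aM[OF ij(2)] by blast+
      with not_both show ?thesis by blast
    qed
    ultimately show ?thesis using uv arcs_in by blast
  qed
  ultimately show ?thesis using dis unfolding K_model_def by blast
qed

end

lemma bridge_join_commute: "bridge_join A B a b = bridge_join B A b a"
  by (simp add: add_edge_def graph_union_def Un_commute insert_commute)

lemma two_graphs_commute: "two_graphs A B a b \<Longrightarrow> two_graphs B A b a"
  by (auto simp: two_graphs_def)

text \<open>If neither side carries the whole model, some branch set \<open>M i\<close> lies in
  \<open>A\<close> and some \<open>M j\<close> in \<open>B\<close>. They are adjacent only through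
  the bridge and so own its ends, which leaves a third branch set no way to touch both.\<close>

lemma (in two_graphs) K_minor_free_bridge_join:
  assumes r: "r \<ge> 3" and fA: "K_minor_free r A" and fB: "K_minor_free r B"
  shows "K_minor_free r (bridge_join A B a b)"
proof -
  let ?G = "bridge_join A B a b"
  have False if M: "K_model r ?G M" for M
  proof -
    have sub: "M i \<subseteq> pverts A \<union> pverts B" and con: "cut_connected (M i) (parcs ?G)" if "i < r" for i
      using M that by (auto simp: K_model_def bridge_join_simps)
    have dis: "M i \<inter> M j = {}" and adj: "parcs ?G \<inter> M i \<times> M j \<noteq> {}" if "i < r" "j < r" "i \<noteq> j" for i j
      using M that by (auto simp: K_model_def)
    obtain j where j: "j < r" "M j \<inter> pverts A = {}"
      using K_model_restrict_to_side[OF M] fA A by (auto simp: K_minor_free_iff)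
    interpret BA: two_graphs B A b a by (rule two_graphs_commute) unfold_locales
    obtain i where i: "i < r" "M i \<inter> pverts B = {}"
      using BA.K_model_restrict_to_side[of r M] M fB B unfolding bridge_join_commute[of A]
      by (auto simp: K_minor_free_iff)
    have Mj: "M j \<subseteq> pverts B" and Mi: "M i \<subseteq> pverts A" using sub i j by blast+
    have "M i \<noteq> {}" using con[OF i(1)] by (simp add: cut_connected_def)
    then have ij: "i \<noteq> j" using Mi j by blast
    have link: "u = a \<and> v = b" if "u \<in> pverts A" "v \<in> pverts B" "(u, v) \<in> parcs ?G" for u v
      using bridge_join_arcD(1)[OF that(3,1)] arcs_in disj that by blast
    have ab: "a \<in> M i" "b \<in> M j"
      using adj[OF i(1) j(1) ij] Mi Mj link by blast+
    \<comment> \<open>The third branch set exists because \<open>r \<ge> 3\<close>.\<close>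
    obtain k where k: "k < r" "k \<noteq> i" "k \<noteq> j"
    proof -
      have "card {i, j} < card {..<r}" using r by (auto simp: card_insert_if)
      then have "\<not> {..<r} \<subseteq> {i, j}" by (meson card_mono finite.emptyI finite.insertI not_less)
      then show ?thesis using that by blast
    qed
    have k': "a \<notin> M k" "b \<notin> M k" using ab dis[of k i] dis[of k j] k i j by blast+
    obtain u v where uv: "u \<in> M i" "v \<in> M k" "(u, v) \<in> parcs ?G" using adj[of i k] k i by blast
    \<comment> \<open>\<open>M k\<close> avoids both ends of the bridge, so its contact with
      \<open>M i\<close> lies in \<open>A\<close> and its contact with \<open>M j\<close> lies in
      \<open>B\<close>. Thus \<open>M k\<close> meets both sides and would have to contain the
      bridge ends.\<close>
    have "v \<notin> pverts B" using link[of u v] uv Mi k' by blast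
    moreover obtain u' v' where uv': "u' \<in> M k" "v' \<in> M j" "(u', v') \<in> parcs ?G" using adj[of k j] k j by blast
    have "u' \<notin> pverts A" using link[of u' v'] uv' Mj k' by blast
    ultimately have "M k \<inter> pverts A \<noteq> {}" "M k \<inter> pverts B \<noteq> {}"
      using sub[OF k(1)] uv uv' by blast+
    with bridge_ends_in_connected[OF con[OF k(1)] sub[OF k(1)]] k' show False by blast
  qed
  then show ?thesis using K_minor_free_iff[OF pair_graph_bridge_join] by blast
qed

section \<open>The quadratic form of the adjacency matrix\<close>

text \<open>The quadratic form of the adjacency matrix. An edge consists of two arcs, so an edge
  \<open>uv\<close> contributes \<open>2 * x u * x v\<close>.\<close>

definition adj_form :: "'a pair_pre_digraph \<Rightarrow> ('a \<Rightarrow> real) \<Rightarrow> real" where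
  "adj_form G x = (\<Sum>(u, v)\<in>parcs G. x u * x v)"

definition sq_norm :: "'a pair_pre_digraph \<Rightarrow> ('a \<Rightarrow> real) \<Rightarrow> real" where
  "sq_norm G x = (\<Sum>u\<in>pverts G. (x u)\<^sup>2)"

lemma (in pair_graph) adj_form_neighbours:
  "adj_form G x = (\<Sum>u\<in>pverts G. x u * (\<Sum>v | (u, v) \<in> parcs G. x v))"
proof -
  have fin: "finite {v. (u, v) \<in> parcs G}" for u
    using pair_finite_verts by (rule finite_subset[rotated]) (auto dest: in_arcsD2)
  have "parcs G = (SIGMA u:pverts G. {v. (u, v) \<in> parcs G})" using in_arcsD1 by auto
  then have "adj_form G x = (\<Sum>(u, v)\<in>(SIGMA u:pverts G. {v. (u, v) \<in> parcs G}). x u * x v)"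
    unfolding adj_form_def by simp
  also have "\<dots> = (\<Sum>u\<in>pverts G. \<Sum>v | (u, v) \<in> parcs G. x u * x v)"
    using pair_finite_verts fin by (intro sum.Sigma[symmetric]) auto
  finally show ?thesis by (simp add: sum_distrib_left)
qed

section \<open>Expansions in the eigenbasis and their spectral consequences\<close>

context adjacency_eigenbasis
begin

definition coeff :: "('a \<Rightarrow> real) \<Rightarrow> nat \<Rightarrow> real" where
  "coeff x i = (\<Sum>u\<in>pverts G. x u * e i u)"

lemma expansion: "u \<in> pverts G \<Longrightarrow> x u = (\<Sum>i<card (pverts G). coeff x i * e i u)"
proof -
  assume u: "u \<in> pverts G"
  have "(\<Sum>i<card (pverts G). coeff x i * e i u) = (\<Sum>i<card (pverts G). \<Sum>v\<in>pverts G. x v * (e i v * e i u))"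
    by (simp add: coeff_def sum_distrib_right mult.assoc)
  also have "\<dots> = (\<Sum>v\<in>pverts G. x v * (\<Sum>i<card (pverts G). e i v * e i u))"
    by (subst sum.swap) (simp add: sum_distrib_left)
  also have "\<dots> = (\<Sum>v\<in>pverts G. x v * (if v = u then 1 else 0))"
    by (intro sum.cong refl) (simp add: complete u)
  also have "\<dots> = x u" using u pair_finite_verts by (simp add: if_distrib cong: if_cong)
  finally show ?thesis by simp
qed

lemma neighbour_sum:
  assumes "u \<in> pverts G"
  shows "(\<Sum>v | (u, v) \<in> parcs G. x v) = (\<Sum>i<card (pverts G). d i * coeff x i * e i u)"
proof -
  have "(\<Sum>v | (u, v) \<in> parcs G. x v) = (\<Sum>v | (u, v) \<in> parcs G. \<Sum>i<card (pverts G). coeff x i * e i v)"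
    by (intro sum.cong refl expansion) (auto dest: in_arcsD2)
  also have "\<dots> = (\<Sum>i<card (pverts G). coeff x i * (\<Sum>v | (u, v) \<in> parcs G. e i v))"
    by (subst sum.swap) (simp add: sum_distrib_left)
  also have "\<dots> = (\<Sum>i<card (pverts G). d i * coeff x i * e i u)"
    by (intro sum.cong refl) (simp add: eigen assms)
  finally show ?thesis .
qed

lemma sq_norm_coeff: "sq_norm G x = (\<Sum>i<card (pverts G). (coeff x i)\<^sup>2)"
proof -
  have "sq_norm G x = (\<Sum>u\<in>pverts G. x u * (\<Sum>i<card (pverts G). coeff x i * e i u))"
    unfolding sq_norm_def power2_eq_square by (intro sum.cong refl arg_cong2[of _ _ _ _ "(*)"] expansion)
  also have "\<dots> = (\<Sum>i<card (pverts G). coeff x i * (\<Sum>u\<in>pverts G. x u * e i u))"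
    unfolding sum_distrib_left by (subst sum.swap) (simp add: mult_ac)
  finally show ?thesis by (simp add: coeff_def power2_eq_square)
qed

lemma adj_form_coeff: "adj_form G x = (\<Sum>i<card (pverts G). d i * (coeff x i)\<^sup>2)"
proof -
  have "adj_form G x = (\<Sum>u\<in>pverts G. x u * (\<Sum>i<card (pverts G). d i * coeff x i * e i u))"
    unfolding adj_form_neighbours by (intro sum.cong refl) (simp add: neighbour_sum)
  also have "\<dots> = (\<Sum>i<card (pverts G). d i * coeff x i * (\<Sum>u\<in>pverts G. x u * e i u))"
    unfolding sum_distrib_left by (subst sum.swap) (simp add: mult_ac)
  finally show ?thesis by (simp add: coeff_def power2_eq_square mult_ac)
qed

lemma coeff_basis: "i < card (pverts G) \<Longrightarrow> j < card (pverts G) \<Longrightarrow> coeff (e i) j = (if i = j then 1 else 0)"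
  by (simp add: coeff_def orthonormal)

lemma sq_norm_basis: "i < card (pverts G) \<Longrightarrow> sq_norm G (e i) = 1"
  using orthonormal[of i i] by (simp add: sq_norm_def power2_eq_square)

lemma adj_form_basis: "i < card (pverts G) \<Longrightarrow> adj_form G (e i) = d i"
proof -
  assume i: "i < card (pverts G)"
  have "adj_form G (e i) = (\<Sum>j<card (pverts G). d j * (if i = j then 1 else 0))"
    unfolding adj_form_coeff by (intro sum.cong refl) (simp add: coeff_basis i)
  then show ?thesis using i by (simp add: if_distrib cong: if_cong)
qed

text \<open>Indices start at 0, so \<open>d 1\<close> is the second largest eigenvalue.\<close>

lemma lambda2_eq: "card (pverts G) \<ge> 2 \<Longrightarrow> lambda2 G = d 1"
  by (simp add: lambda2_def eigenvalues)

lemma abs_adj_form_le: "\<bar>adj_form G x\<bar> \<le> adj_form G (\<lambda>u. \<bar>x u\<bar>)"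
  unfolding adj_form_def by (rule order_trans[OF sum_abs]) (auto simp: abs_mult intro!: sum_mono)

lemma sq_norm_abs: "sq_norm G (\<lambda>u. \<bar>x u\<bar>) = sq_norm G x"
  by (simp add: sq_norm_def)

text \<open>A combination orthogonal to the first eigenvector sees only the eigenvalues from the second on.\<close>

lemma two_dim_le_lambda2:
  assumes n: "card (pverts G) \<ge> 2"
  obtains \<alpha> \<beta> where "\<alpha> \<noteq> 0 \<or> \<beta> \<noteq> 0"
    "adj_form G (\<lambda>u. \<alpha> * x u + \<beta> * y u) \<le> lambda2 G * sq_norm G (\<lambda>u. \<alpha> * x u + \<beta> * y u)"
proof -
  have lin: "coeff (\<lambda>u. \<alpha> * x u + \<beta> * y u) 0 = \<alpha> * coeff x 0 + \<beta> * coeff y 0" for \<alpha> \<beta>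
    by (simp add: coeff_def sum_distrib_left sum.distrib algebra_simps)
  obtain \<alpha> \<beta> where ab: "\<alpha> \<noteq> 0 \<or> \<beta> \<noteq> 0" "\<alpha> * coeff x 0 + \<beta> * coeff y 0 = 0"
  proof (cases "coeff y 0 = 0")
    case True
    then show ?thesis using that[of 0 1] by simp
  next
    case False
    then show ?thesis using that[of "coeff y 0" "- coeff x 0"] by simp
  qed
  let ?z = "\<lambda>u. \<alpha> * x u + \<beta> * y u"
  have "d i * (coeff ?z i)\<^sup>2 \<le> d 1 * (coeff ?z i)\<^sup>2" if "i < card (pverts G)" for i
    using that lin[of \<alpha> \<beta>] ab decreasing[of 1 i] by (cases "i = 0") (auto intro: mult_right_mono)
  then have "adj_form G ?z \<le> d 1 * sq_norm G ?z"
    unfolding adj_form_coeff sq_norm_coeff sum_distrib_left by (intro sum_mono) auto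
  then show ?thesis using that ab(1) lambda2_eq[OF n] by simp
qed

lemma adj_form_le_spectral_radius: "adj_form G x \<le> graph_spectral_radius G * sq_norm G x"
proof -
  have "d i * (coeff x i)\<^sup>2 \<le> graph_spectral_radius G * (coeff x i)\<^sup>2" if "i < card (pverts G)" for i
  proof -
    have "\<bar>d i\<bar> \<le> graph_spectral_radius G" unfolding radius using that by (intro Max_ge) auto
    then show ?thesis by (intro mult_right_mono) auto
  qed
  then show ?thesis
    unfolding adj_form_coeff sq_norm_coeff sum_distrib_left by (intro sum_mono) auto
qed

text \<open>The radius is some \<open>\<bar>d i\<bar>\<close>. Passing to absolute values in
  \<open>e i\<close> keeps the norm and makes the form at least
  \<open>\<bar>d i\<bar>\<close>.\<close>

lemma spectral_radius_attained:
  assumes "pverts G \<noteq> {}"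
  obtains x where "\<forall>u. x u \<ge> 0" "sq_norm G x = 1" "adj_form G x \<ge> graph_spectral_radius G"
proof -
  have "card (pverts G) > 0" using assms pair_finite_verts by (simp add: card_gt_0_iff)
  then have "graph_spectral_radius G \<in> (\<lambda>i. \<bar>d i\<bar>) ` {..<card (pverts G)}"
    unfolding radius by (intro Max_in) auto
  then obtain i where i: "i < card (pverts G)" "graph_spectral_radius G = \<bar>d i\<bar>" by auto
  show ?thesis
    by (rule that[of "\<lambda>u. \<bar>e i u\<bar>"])
      (use i abs_adj_form_le[of "e i"] in \<open>simp_all add: sq_norm_abs sq_norm_basis adj_form_basis\<close>)
qed

text \<open>The absolute value of the first eigenvector is again an eigenvector for
  \<open>d 0\<close>, and connectedness makes it positive. A nonzero eigenvector for
  \<open>d 1\<close> orthogonal to a positive vector must take both signs.\<close>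

lemma lambda2_eigenvector_changes_sign:
  assumes n: "card (pverts G) \<ge> 2" and con: "cut_connected (pverts G) (parcs G)"
  obtains y where "\<forall>u\<in>pverts G. (\<Sum>v | (u, v) \<in> parcs G. y v) = lambda2 G * y u"
    "\<exists>u\<in>pverts G. y u > 0" "\<exists>u\<in>pverts G. y u < 0"
proof -
  have i01: "0 < card (pverts G)" "1 < card (pverts G)" using n by auto
  define x where "x u = \<bar>e 0 u\<bar>" for u
  \<comment> \<open>Both sides are forms of \<open>x\<close> in coordinates: \<open>x\<close> has
    norm 1 and Rayleigh quotient at least \<open>d 0\<close>, the largest eigenvalue. So
    \<open>x\<close> has no component outside the eigenspace of \<open>d 0\<close>.\<close>
  have "(\<Sum>i<card (pverts G). d 0 * (coeff x i)\<^sup>2) \<le> (\<Sum>i<card (pverts G). d i * (coeff x i)\<^sup>2)"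
    using abs_adj_form_le[of "e 0"] sq_norm_abs[of "e 0"]
    unfolding sum_distrib_left[symmetric] adj_form_coeff[symmetric] sq_norm_coeff[symmetric] x_def[symmetric]
    by (simp add: sq_norm_basis adj_form_basis i01)
  then have "(\<Sum>i<card (pverts G). (d 0 - d i) * (coeff x i)\<^sup>2) \<le> 0"
    by (simp add: left_diff_distrib sum_subtractf)
  moreover have nn: "(d 0 - d i) * (coeff x i)\<^sup>2 \<ge> 0" if "i < card (pverts G)" for i
    using decreasing[of 0 i] that by simp
  ultimately have "(\<Sum>i<card (pverts G). (d 0 - d i) * (coeff x i)\<^sup>2) = 0"
    by (intro antisym sum_nonneg) auto
  then have "(d 0 - d i) * (coeff x i)\<^sup>2 = 0" if "i < card (pverts G)" for i
    using sum_nonneg_eq_0_iff[of "{..<card (pverts G)}" "\<lambda>i. (d 0 - d i) * (coeff x i)\<^sup>2"] nn that by auto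
  then have zero: "coeff x i = 0 \<or> d i = d 0" if "i < card (pverts G)" for i using that by fastforce
  have xeig: "(\<Sum>v | (u, v) \<in> parcs G. x v) = d 0 * x u" if u: "u \<in> pverts G" for u
  proof -
    have "(\<Sum>v | (u, v) \<in> parcs G. x v) = (\<Sum>i<card (pverts G). d 0 * (coeff x i * e i u))"
      unfolding neighbour_sum[OF u] using zero by (intro sum.cong refl) auto
    also have "\<dots> = d 0 * x u" using expansion[OF u, of x] by (simp add: sum_distrib_left)
    finally show ?thesis .
  qed
  have xpos: "x u > 0" if "u \<in> pverts G" for u
  proof (rule ccontr)
    \<comment> \<open>By connectedness an edge \<open>ab\<close> would lead from a zero of
      \<open>x\<close> to a positive value; the eigenvalue equation at \<open>a\<close> then equates
      a positive sum with 0.\<close>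
    let ?Z = "{u \<in> pverts G. x u = 0}"
    assume "\<not> x u > 0"
    then have Z: "?Z \<noteq> {}" using that by (auto simp: x_def)
    moreover have "?Z \<noteq> pverts G"
    proof
      assume "?Z = pverts G"
      then have "sq_norm G x = 0" by (auto simp: sq_norm_def intro!: sum.neutral)
      then show False using sq_norm_abs[of "e 0"] sq_norm_basis[OF i01(1)] unfolding x_def[symmetric] by simp
    qed
    ultimately obtain a b where ab: "a \<in> ?Z" "b \<in> pverts G" "b \<notin> ?Z" "(a, b) \<in> parcs G"
      using cut_connectedD[OF con, of ?Z] by blast
    have "finite {v. (a, v) \<in> parcs G}"
      using pair_finite_verts by (rule finite_subset[rotated]) (auto dest: in_arcsD2)
    then have "x b \<le> (\<Sum>v | (a, v) \<in> parcs G. x v)"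
      using ab by (intro member_le_sum) (auto simp: x_def)
    also have "\<dots> = 0" using xeig[of a] ab by simp
    finally show False using ab by (auto simp: x_def)
  qed
  obtain y where yeig: "\<forall>u\<in>pverts G. (\<Sum>v | (u, v) \<in> parcs G. y v) = d 1 * y u"
    and orth: "(\<Sum>u\<in>pverts G. x u * y u) = 0" and y0: "\<exists>u\<in>pverts G. y u \<noteq> 0"
  proof (cases "coeff x 1 = 0")
    case True
    have "\<exists>u\<in>pverts G. e 1 u \<noteq> 0"
    proof (rule ccontr)
      assume "\<not> ?thesis"
      then have "sq_norm G (e 1) = 0" by (simp add: sq_norm_def)
      with sq_norm_basis[OF i01(2)] show False by simp
    qed
    then show ?thesis using that[of "e 1"] True eigen[OF i01(2)] by (simp add: coeff_def)
  next
    case False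
    then have d: "d 0 = d 1" using zero[OF i01(2)] by auto
    \<comment> \<open>If \<open>e 1\<close> is not orthogonal to \<open>x\<close>, then
      \<open>d 0 = d 1\<close>, and this combination of \<open>e 0\<close> and \<open>e 1\<close>
      cancels the inner product with \<open>x\<close> while remaining an eigenvector.\<close>
    let ?y = "\<lambda>u. coeff x 1 * e 0 u - coeff x 0 * e 1 u"
    have "\<exists>u\<in>pverts G. ?y u \<noteq> 0"
    proof (rule ccontr)
      assume "\<not> ?thesis"
      then have "coeff ?y 0 = 0" by (simp add: coeff_def)
      moreover have "coeff ?y 0 = coeff x 1 * coeff (e 0) 0 - coeff x 0 * coeff (e 1) 0"
        unfolding coeff_def[of ?y] coeff_def[of "e _"]
        by (simp add: left_diff_distrib sum_subtractf sum_distrib_left mult.assoc)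
      ultimately show False using False coeff_basis[OF i01(1) i01(1)] coeff_basis[OF i01(2) i01(1)] by simp
    qed
    moreover have "(\<Sum>u\<in>pverts G. x u * ?y u) =
        coeff x 1 * (\<Sum>u\<in>pverts G. x u * e 0 u) - coeff x 0 * (\<Sum>u\<in>pverts G. x u * e 1 u)"
      by (simp add: sum_distrib_left right_diff_distrib sum_subtractf mult_ac)
    then have "(\<Sum>u\<in>pverts G. x u * ?y u) = 0" unfolding coeff_def[symmetric] by simp
    moreover have "(\<Sum>v | (u, v) \<in> parcs G. ?y v) = d 1 * ?y u" if u: "u \<in> pverts G" for u
    proof -
      have "(\<Sum>v | (u, v) \<in> parcs G. ?y v) =
          coeff x 1 * (\<Sum>v | (u, v) \<in> parcs G. e 0 v) - coeff x 0 * (\<Sum>v | (u, v) \<in> parcs G. e 1 v)"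
        by (simp add: sum_subtractf sum_distrib_left)
      also have "\<dots> = d 1 * ?y u"
        unfolding eigen[OF i01(1) u] eigen[OF i01(2) u] d by (simp add: algebra_simps)
      finally show ?thesis .
    qed
    ultimately show ?thesis using that[of ?y] by blast
  qed
  \<comment> \<open>The factor \<open>s\<close> treats both signs at once: were \<open>s * y\<close>
    nowhere positive, orthogonality to the positive \<open>x\<close> would force \<open>y\<close> to
    vanish.\<close>
  have sign: "\<exists>u\<in>pverts G. s * y u > 0" if s: "s = 1 \<or> s = -1" for s :: real
  proof (rule ccontr)
    assume "\<not> ?thesis"
    then have le: "x u * - (s * y u) \<ge> 0" if "u \<in> pverts G" for u
      using that xpos[OF that] by (intro mult_nonneg_nonneg) (auto simp: not_less)
    have "(\<Sum>u\<in>pverts G. x u * - (s * y u)) = - s * (\<Sum>u\<in>pverts G. x u * y u)"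
      by (simp add: sum_distrib_left mult_ac sum_negf)
    then have "(\<Sum>u\<in>pverts G. x u * - (s * y u)) = 0" by (simp add: orth)
    then have z: "x u * - (s * y u) = 0" if "u \<in> pverts G" for u
      using sum_nonneg_eq_0_iff[of "pverts G" "\<lambda>u. x u * - (s * y u)"] pair_finite_verts le that by simp
    from y0 obtain u where "u \<in> pverts G" "y u \<noteq> 0" by blast
    with z[of u] xpos[of u] s show False by auto
  qed
  show ?thesis using that[of y] yeig sign[of 1] sign[of "-1"] lambda2_eq[OF n] by simp
qed

end

section \<open>Building minor-free graphs\<close>

lemma adj_form_cong: "pair_graph G \<Longrightarrow> (\<And>u. u \<in> pverts G \<Longrightarrow> x u = y u) \<Longrightarrow> adj_form G x = adj_form G y"
  unfolding adj_form_def by (rule sum.cong) (auto simp: pair_graph_iff)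

lemma sq_norm_cong: "(\<And>u. u \<in> pverts G \<Longrightarrow> x u = y u) \<Longrightarrow> sq_norm G x = sq_norm G y"
  unfolding sq_norm_def by (rule sum.cong) auto

lemma adj_form_scale: "adj_form G (\<lambda>u. c * x u) = c\<^sup>2 * adj_form G x"
  by (simp add: adj_form_def sum_distrib_left power2_eq_square mult_ac split_def)

lemma sq_norm_scale: "sq_norm G (\<lambda>u. c * x u) = c\<^sup>2 * sq_norm G x"
  by (simp add: sq_norm_def sum_distrib_left power_mult_distrib)

lemma sq_norm_pos: "finite (pverts G) \<Longrightarrow> u \<in> pverts G \<Longrightarrow> x u \<noteq> 0 \<Longrightarrow> sq_norm G x > 0"
  unfolding sq_norm_def by (rule sum_pos2[of _ u]) auto

lemma (in two_graphs) adj_form_bridge_join: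
  "adj_form (bridge_join A B a b) x = adj_form A x + adj_form B x + 2 * x a * x b"
proof -
  have fin: "finite (parcs A)" "finite (parcs B)"
    using A B finite_subset[OF arcs_in(1)] finite_subset[OF arcs_in(2)] by (simp_all add: pair_graph_iff)
  have "(pverts A \<times> pverts A) \<inter> (pverts B \<times> pverts B) = {}" using disj by blast
  then have "parcs A \<inter> parcs B = {}" using arcs_in by blast
  moreover have ab: "a \<notin> pverts B" "b \<notin> pverts A" using disj a b by blast+
  moreover have "(parcs A \<union> parcs B) \<inter> {(a, b), (b, a)} = {}" using ab arcs_in by blast
  moreover have "a \<noteq> b" using ab a by blast
  ultimately show ?thesis
    unfolding adj_form_def bridge_join_simps using fin by (simp add: sum.union_disjoint)
qed

lemma (in two_graphs) sq_norm_bridge_join: "sq_norm (bridge_join A B a b) x = sq_norm A x + sq_norm B x"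
  unfolding sq_norm_def bridge_join_simps using A B disj by (simp add: sum.union_disjoint pair_graph_iff)

section \<open>One-vertex graphs and relabelled copies\<close>

definition single_vertex :: "'a \<Rightarrow> 'a pair_pre_digraph" where
  "single_vertex w = \<lparr>pverts = {w}, parcs = {}\<rparr>"

lemma single_vertex_simps [simp]: "pverts (single_vertex w) = {w}" "parcs (single_vertex w) = {}"
  by (simp_all add: single_vertex_def)

lemma pair_graph_single_vertex: "pair_graph (single_vertex w)"
  by (simp add: pair_graph_iff sym_def)

lemma cut_connected_single_vertex: "cut_connected {w} R"
  by (auto simp: cut_connected_def)

lemma K_minor_free_single_vertex:
  assumes "r \<ge> 2" shows "K_minor_free r (single_vertex w)"
proof -
  have False if M: "K_model r (single_vertex w) M" for M
  proof -
    have "M i = {w}" if "i < r" for i using M that by (auto simp: K_model_def cut_connected_def)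
    then have "M 0 = {w}" "M 1 = {w}" using assms by auto
    moreover have "\<forall>i<r. \<forall>j<r. i \<noteq> j \<longrightarrow> M i \<inter> M j = {}" using M unfolding K_model_def by blast
    then have "0 < r \<longrightarrow> 1 < r \<longrightarrow> (0::nat) \<noteq> 1 \<longrightarrow> M 0 \<inter> M 1 = {}" by blast
    then have "M 0 \<inter> M 1 = {}" using assms by simp
    ultimately show False by simp
  qed
  then show ?thesis using K_minor_free_iff[OF pair_graph_single_vertex, of r w] by blast
qed

definition map_graph :: "('a \<Rightarrow> 'b) \<Rightarrow> 'a pair_pre_digraph \<Rightarrow> 'b pair_pre_digraph" where
  "map_graph f G = \<lparr>pverts = f ` pverts G, parcs = map_prod f f ` parcs G\<rparr>"

lemma map_graph_simps: "pverts (map_graph f G) = f ` pverts G" "parcs (map_graph f G) = map_prod f f ` parcs G"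
  by (simp_all add: map_graph_def)

context
  fixes f :: "'a \<Rightarrow> 'b" assumes f: "inj f"
begin

lemma map_graph_arc_iff: "(f u, f v) \<in> parcs (map_graph f G) \<longleftrightarrow> (u, v) \<in> parcs G"
  using f by (auto simp: map_graph_simps dest: injD)

lemma pair_graph_map_graph:
  assumes "pair_graph G"
  shows "pair_graph (map_graph f G)"
  unfolding pair_graph_iff
proof (intro conjI allI notI symI)
  show "finite (pverts (map_graph f G))" "parcs (map_graph f G) \<subseteq> pverts (map_graph f G) \<times> pverts (map_graph f G)"
    using assms by (auto simp: pair_graph_iff map_graph_simps)
  fix x y assume "(x, y) \<in> parcs (map_graph f G)"
  then show "(y, x) \<in> parcs (map_graph f G)"
    using assms by (force simp: pair_graph_iff map_graph_simps dest: symD)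
next
  fix x assume "(x, x) \<in> parcs (map_graph f G)"
  then show False using assms f by (auto simp: pair_graph_iff map_graph_simps dest: injD)
qed

lemma card_map_graph: "card (pverts (map_graph f G)) = card (pverts G)"
  using f by (simp add: map_graph_simps card_image inj_on_subset)

lemma cut_connected_vimage:
  assumes "cut_connected M (parcs (map_graph f G))" "M \<subseteq> range f"
  shows "cut_connected (f -` M) (parcs G)"
  unfolding cut_connected_def
proof (intro conjI allI impI)
  show "f -` M \<noteq> {}" using assms by (auto simp: cut_connected_def)
  fix S assume S: "S \<subseteq> f -` M \<and> S \<noteq> {} \<and> S \<noteq> f -` M"
  have fS: "f ` S \<subseteq> M" using S by auto
  have "f ` S \<noteq> M" using S f by (auto dest: injD)
  then obtain u v where uv: "u \<in> f ` S" "v \<in> M" "v \<notin> f ` S" "(u, v) \<in> parcs (map_graph f G)"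
    using cut_connectedD[OF assms(1) fS] S by blast
  then obtain u' v' where "u = f u'" "v = f v'" "u' \<in> S" using assms(2) by blast
  with uv show "parcs G \<inter> S \<times> (f -` M - S) \<noteq> {}" by (auto simp: map_graph_arc_iff)
qed

lemma cut_connected_map_graph:
  assumes "cut_connected (pverts G) (parcs G)"
  shows "cut_connected (pverts (map_graph f G)) (parcs (map_graph f G))"
  unfolding cut_connected_def
proof (intro conjI allI impI)
  show "pverts (map_graph f G) \<noteq> {}" using assms by (simp add: cut_connected_def map_graph_simps)
  fix S assume S: "S \<subseteq> pverts (map_graph f G) \<and> S \<noteq> {} \<and> S \<noteq> pverts (map_graph f G)"
  let ?T = "f -` S \<inter> pverts G"
  have "?T \<noteq> {}" "?T \<noteq> pverts G" using S by (auto simp: map_graph_simps)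
  then obtain u v where "u \<in> ?T" "v \<in> pverts G" "v \<notin> ?T" "(u, v) \<in> parcs G"
    using cut_connectedD[OF assms, of ?T] by blast
  then show "parcs (map_graph f G) \<inter> S \<times> (pverts (map_graph f G) - S) \<noteq> {}"
    using map_graph_arc_iff[of u v G] by (auto simp: map_graph_simps)
qed

text \<open>A model in the copy pulls back along \<open>f\<close>: preimages of branch sets remain
  connected, disjoint and adjacent.\<close>

lemma K_minor_free_map_graph:
  assumes G: "pair_graph G" and free: "K_minor_free r G"
  shows "K_minor_free r (map_graph f G)"
proof -
  have "K_model r G (\<lambda>i. f -` M i)" if M: "K_model r (map_graph f G) M" for M
    unfolding K_model_def
  proof (intro conjI allI impI)
    have sub: "M i \<subseteq> f ` pverts G" if "i < r" for i using M that by (auto simp: K_model_def map_graph_simps)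
    fix i assume i: "i < r"
    show "f -` M i \<subseteq> pverts G" using sub[OF i] f by (auto dest: injD)
    show "cut_connected (f -` M i) (parcs G)"
    proof (rule cut_connected_vimage)
      show "cut_connected (M i) (parcs (map_graph f G))" using M i by (auto simp: K_model_def)
      show "M i \<subseteq> range f" using sub[OF i] by blast
    qed
    fix j assume j: "j < r" "i \<noteq> j"
    have "M i \<inter> M j = {}" using M i j by (auto simp: K_model_def)
    then show "f -` M i \<inter> f -` M j = {}" by auto
    have "parcs (map_graph f G) \<inter> M i \<times> M j \<noteq> {}" using M i j by (auto simp: K_model_def)
    then show "parcs G \<inter> f -` M i \<times> f -` M j \<noteq> {}" by (auto simp: map_graph_simps)
  qed
  then show ?thesis using free K_minor_free_iff[OF G] K_minor_free_iff[OF pair_graph_map_graph[OF G]] by blast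
qed

lemma adj_form_map_graph: "adj_form (map_graph f G) x = adj_form G (x \<circ> f)"
proof -
  have "inj_on (map_prod f f) (parcs G)" using f by (auto intro!: inj_onI dest: injD)
  then show ?thesis by (simp add: adj_form_def map_graph_simps sum.reindex o_def split_def)
qed

lemma sq_norm_map_graph: "sq_norm (map_graph f G) x = sq_norm G (x \<circ> f)"
  using f by (simp add: sq_norm_def map_graph_simps sum.reindex inj_on_subset o_def)

end

lemma disjoint_copy_exists:
  assumes "finite V" "finite F"
  obtains f :: "nat \<Rightarrow> nat" where "inj f" "f ` V \<inter> F = {}"
proof -
  obtain k where "\<forall>v\<in>F. v < k" using assms(2) finite_nat_set_iff_bounded by blast
  \<comment> \<open>Shifting by a strict upper bound \<open>k\<close> of \<open>F\<close> moves
    every image out of \<open>F\<close>.\<close>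
  then show ?thesis using that[of "\<lambda>v. v + k"] by fastforce
qed

section \<open>Induced subgraphs and edge-maximal supergraphs\<close>

definition induced :: "'a pair_pre_digraph \<Rightarrow> 'a set \<Rightarrow> 'a pair_pre_digraph" where
  "induced G S = \<lparr>pverts = S, parcs = parcs G \<inter> S \<times> S\<rparr>"

lemma induced_simps [simp]: "pverts (induced G S) = S" "parcs (induced G S) = parcs G \<inter> S \<times> S"
  by (simp_all add: induced_def)

lemma pair_graph_induced: "pair_graph G \<Longrightarrow> S \<subseteq> pverts G \<Longrightarrow> pair_graph (induced G S)"
  by (auto simp: pair_graph_iff sym_def intro: finite_subset)

lemma K_minor_free_induced:
  "pair_graph G \<Longrightarrow> S \<subseteq> pverts G \<Longrightarrow> K_minor_free r G \<Longrightarrow> K_minor_free r (induced G S)"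
  by (rule K_minor_free_mono[of G]) (auto intro: pair_graph_induced)

text \<open>A minor-free graph with the largest number of edges on its vertex set is connected, because a
  bridge between two components creates no complete minor.\<close>

lemma connected_supergraph:
  assumes r: "r \<ge> 3" and G: "pair_graph G" "K_minor_free r G" "pverts G \<noteq> {}"
  obtains H where "pair_graph H" "K_minor_free r H" "pverts H = pverts G" "parcs G \<subseteq> parcs H"
    "cut_connected (pverts H) (parcs H)"
proof -
  let ?V = "pverts G"
  let ?g = "\<lambda>R. \<lparr>pverts = ?V, parcs = R\<rparr>"
  define C where "C = {R. pair_graph (?g R) \<and> K_minor_free r (?g R)}"
  have "C \<subseteq> Pow (?V \<times> ?V)" by (auto simp: C_def pair_graph_iff)
  moreover have "finite (Pow (?V \<times> ?V))" using G(1) by (simp add: pair_graph_iff)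
  ultimately have "finite C" by (rule finite_subset)
  moreover have g: "?g (parcs G) = G" by (cases G) simp
  have "parcs G \<in> C" unfolding C_def mem_Collect_eq g using G by blast
  ultimately obtain R where R: "R \<in> C" "parcs G \<subseteq> R" and max: "\<And>R'. R' \<in> C \<Longrightarrow> R \<subseteq> R' \<Longrightarrow> R = R'"
    using finite_has_maximal2[of C "parcs G"] by blast
  let ?H = "?g R"
  have H: "pair_graph ?H" "K_minor_free r ?H" using R by (auto simp: C_def)
  have "cut_connected ?V R" unfolding cut_connected_def
  proof (intro conjI allI impI notI)
    fix S assume S: "S \<subseteq> ?V \<and> S \<noteq> {} \<and> S \<noteq> ?V" and no: "R \<inter> S \<times> (?V - S) = {}"
    then obtain a b where ab: "a \<in> S" "b \<in> ?V - S" by blast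
    interpret two_graphs "induced ?H S" "induced ?H (?V - S)" a b
      by (rule two_graphs.intro) (use S ab pair_graph_induced[OF H(1)] in simp_all)
    have "sym R" and RV: "R \<subseteq> ?V \<times> ?V" using H(1) by (simp_all add: pair_graph_iff)
    have "u \<in> S \<longleftrightarrow> v \<in> S" if uv: "(u, v) \<in> R" for u v
    proof -
      have "(v, u) \<in> R" using \<open>sym R\<close> uv by (rule symD)
      moreover have "u \<in> ?V" "v \<in> ?V" using RV uv by auto
      ultimately show ?thesis using no uv by blast
    qed
    then have "e \<in> R \<inter> S \<times> S \<union> R \<inter> (?V - S) \<times> (?V - S)" if "e \<in> R" for e
      using RV that by (cases e) auto
    then have "R \<inter> S \<times> S \<union> R \<inter> (?V - S) \<times> (?V - S) = R" by blast
    moreover have "S \<union> (?V - S) = ?V" using S by blast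
    \<comment> \<open>With no arc across the cut, the graph is the disjoint union of its two sides,
      so adding the edge \<open>ab\<close> is a bridge join and contradicts the maximality of
      \<open>R\<close>.\<close>
    ultimately have "bridge_join (induced ?H S) (induced ?H (?V - S)) a b = ?g (R \<union> {(a, b), (b, a)})"
      by (simp add: add_edge_def graph_union_def)
    moreover have "K_minor_free r (bridge_join (induced ?H S) (induced ?H (?V - S)) a b)"
    proof (rule K_minor_free_bridge_join[OF r])
      show "K_minor_free r (induced ?H S)" "K_minor_free r (induced ?H (?V - S))"
        using K_minor_free_induced[OF H(1) _ H(2)] S by simp_all
    qed
    ultimately have "R \<union> {(a, b), (b, a)} \<in> C" using pair_graph_bridge_join by (simp add: C_def)
    then have "R = R \<union> {(a, b), (b, a)}" using max Un_upper1 by metis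
    then have "(a, b) \<in> R" by blast
    with no ab show False by blast
  qed (use G in auto)
  then show ?thesis using that[of ?H] H R by simp
qed

section \<open>Candidates for the second eigenvalue\<close>

text \<open>The competitors in \<open>max_lambda2\<close>, with connectedness in its cut
  form.\<close>

definition admissible :: "nat \<Rightarrow> nat \<Rightarrow> 'a pair_pre_digraph \<Rightarrow> bool" where
  "admissible r k H \<longleftrightarrow> pair_graph H \<and> cut_connected (pverts H) (parcs H) \<and> K_minor_free r H \<and>
     card (pverts H) = k"

text \<open>A witness that the spectral radius is at least \<open>\<mu>\<close>. The test vector is
  nonnegative so that adding edges cannot lower its form.\<close>

definition rayleigh_ge :: "'a pair_pre_digraph \<Rightarrow> real \<Rightarrow> bool" where
  "rayleigh_ge H \<mu> \<longleftrightarrow> (\<exists>x. (\<forall>u. x u \<ge> 0) \<and> (\<exists>u\<in>pverts H. x u > 0) \<and> adj_form H x \<ge> \<mu> * sq_norm H x)"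

lemma admissibleD:
  assumes "admissible r k H"
  shows "pair_graph H" "cut_connected (pverts H) (parcs H)" "K_minor_free r H" "card (pverts H) = k"
    "finite (pverts H)"
  using assms by (auto simp: admissible_def pair_graph_iff)

lemma (in two_graphs) admissible_bridge_join:
  assumes "r \<ge> 3" "admissible r k A" "admissible r l B"
  shows "admissible r (k + l) (bridge_join A B a b)"
  using assms pair_graph_bridge_join card_bridge_join cut_connected_bridge_join K_minor_free_bridge_join
  by (auto simp: admissible_def)

lemma admissible_single_vertex: "r \<ge> 3 \<Longrightarrow> admissible r 1 (single_vertex w)"
  by (simp add: admissible_def pair_graph_single_vertex cut_connected_single_vertex K_minor_free_single_vertex)

lemma admissible_map_graph: "inj f \<Longrightarrow> admissible r k H \<Longrightarrow> admissible r k (map_graph f H)"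
  unfolding admissible_def
  using pair_graph_map_graph cut_connected_map_graph K_minor_free_map_graph card_map_graph by blast

lemma rayleigh_ge_mono: "rayleigh_ge H \<mu> \<Longrightarrow> \<nu> \<le> \<mu> \<Longrightarrow> rayleigh_ge H \<nu>"
proof -
  assume "rayleigh_ge H \<mu>" and le: "\<nu> \<le> \<mu>"
  then obtain x where x: "\<forall>u. x u \<ge> 0" "\<exists>u\<in>pverts H. x u > 0" "adj_form H x \<ge> \<mu> * sq_norm H x"
    by (auto simp: rayleigh_ge_def)
  have "\<nu> * sq_norm H x \<le> \<mu> * sq_norm H x"
    using le by (intro mult_right_mono) (auto simp: sq_norm_def sum_nonneg)
  with x show "rayleigh_ge H \<nu>" unfolding rayleigh_ge_def by (intro exI[of _ x]) auto
qed

lemma adj_form_mono: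
  assumes "pair_graph H" "parcs G \<subseteq> parcs H" "\<forall>u. x u \<ge> 0"
  shows "adj_form G x \<le> adj_form H x"
  unfolding adj_form_def
proof (rule sum_mono2)
  show "finite (parcs H)"
    using assms(1) finite_subset[of "parcs H" "pverts H \<times> pverts H"] by (simp add: pair_graph_iff)
qed (use assms in auto)

text \<open>The same nonnegative test vector works in a connected minor-free supergraph on the same
  vertices.\<close>

lemma rayleigh_connected_supergraph:
  fixes G :: "'a pair_pre_digraph"
  assumes r: "r \<ge> 3" and G: "pair_graph G" "K_minor_free r G" and R: "rayleigh_ge G \<mu>"
  obtains H :: "'a pair_pre_digraph" where "admissible r (card (pverts G)) H" "rayleigh_ge H \<mu>"
proof -
  obtain x where x: "\<forall>u. x u \<ge> 0" "\<exists>u\<in>pverts G. x u > 0" "adj_form G x \<ge> \<mu> * sq_norm G x"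
    using R by (auto simp: rayleigh_ge_def)
  then have "pverts G \<noteq> {}" by auto
  from connected_supergraph[OF r G this] obtain H where H: "pair_graph H" "K_minor_free r H"
    "pverts H = pverts G" "parcs G \<subseteq> parcs H" "cut_connected (pverts H) (parcs H)" .
  have "rayleigh_ge H \<mu>" unfolding rayleigh_ge_def
    using x adj_form_mono[OF H(1,4) x(1)] H(3) by (intro exI[of _ x]) (auto simp: sq_norm_def)
  then show ?thesis using that[of H] H by (auto simp: admissible_def)
qed

text \<open>Giving a new pendant vertex a small positive weight raises the Rayleigh quotient, even when
  the new vertex carries a loop of weight \<open>-1\<close>.\<close>

lemma pendant_vertex:
  fixes H :: "nat pair_pre_digraph"
  assumes r: "r \<ge> 3" and H: "admissible r k H" and R: "rayleigh_ge H \<mu>"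
  obtains H' :: "nat pair_pre_digraph" and p \<nu> z where "admissible r (Suc k) H'" "p \<in> pverts H'" "\<nu> > \<mu>" "\<forall>u. z u \<ge> 0"
    "\<exists>u\<in>pverts H'. z u > 0" "adj_form H' z - (z p)\<^sup>2 \<ge> \<nu> * sq_norm H' z"
proof -
  obtain x u where x: "\<forall>u. x u \<ge> 0" "u \<in> pverts H" "x u > 0" "adj_form H x \<ge> \<mu> * sq_norm H x"
    using R by (auto simp: rayleigh_ge_def)
  have fin: "finite (pverts H)" using H by (simp add: admissible_def pair_graph_iff)
  obtain p where p: "p \<notin> pverts H" using ex_new_if_finite[OF infinite_UNIV_nat fin] by blast
  interpret two_graphs H "single_vertex p" u p
    by (rule two_graphs.intro) (use H x p in \<open>auto simp: admissible_def pair_graph_single_vertex\<close>)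
  let ?H = "bridge_join H (single_vertex p) u p"
  \<comment> \<open>With this weight the gain \<open>2 * x u * \<epsilon>\<close> from the new edge
    exceeds \<open>(\<mu> + 1) * \<epsilon>\<^sup>2\<close>, the cost of the larger norm plus the
    loop.\<close>
  define \<epsilon> where "\<epsilon> = x u / (1 + \<bar>\<mu>\<bar>)"
  have eps: "\<epsilon> > 0" "\<epsilon> * (1 + \<bar>\<mu>\<bar>) = x u" using x by (auto simp: \<epsilon>_def)
  define z where "z = x(p := \<epsilon>)"
  have zH: "v \<in> pverts H \<Longrightarrow> z v = x v" for v using p by (auto simp: z_def)
  have form: "adj_form ?H z = adj_form H x + 2 * x u * \<epsilon>"
    unfolding adj_form_bridge_join using adj_form_cong[OF A zH] x zH by (simp add: adj_form_def z_def)
  have sq: "sq_norm ?H z = sq_norm H x + \<epsilon>\<^sup>2"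
    unfolding sq_norm_bridge_join using sq_norm_cong[OF zH, of H] by (simp add: sq_norm_def z_def)
  have sqpos: "sq_norm ?H z > 0"
    by (rule sq_norm_pos[of _ p]) (use fin eps in \<open>auto simp: bridge_join_simps z_def\<close>)
  define \<nu> where "\<nu> = (adj_form ?H z - (z p)\<^sup>2) / sq_norm ?H z"
  have "\<mu> * \<epsilon>\<^sup>2 + \<epsilon>\<^sup>2 \<le> \<epsilon>\<^sup>2 * (1 + \<bar>\<mu>\<bar>)" by (simp add: algebra_simps mult_right_mono)
  also have "\<dots> = \<epsilon> * x u" using eps(2) by (simp add: power2_eq_square mult.assoc)
  also have "\<dots> < 2 * x u * \<epsilon>" using eps x by simp
  finally have "\<mu> * sq_norm ?H z < adj_form ?H z - (z p)\<^sup>2"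
    unfolding form sq using x(4) by (simp add: z_def algebra_simps)
  then have "\<mu> < \<nu>" using sqpos by (simp add: \<nu>_def pos_less_divide_eq)
  moreover have "admissible r (k + 1) ?H" by (intro admissible_bridge_join r H admissible_single_vertex)
  moreover have "adj_form ?H z - (z p)\<^sup>2 \<ge> \<nu> * sq_norm ?H z" using sqpos by (simp add: \<nu>_def)
  moreover have "\<forall>u. z u \<ge> 0" "p \<in> pverts ?H" "z p > 0"
    using x eps by (auto simp: z_def bridge_join_simps)
  ultimately show ?thesis using that[of ?H p \<nu> z] by auto
qed

lemma rayleigh_ge_pendant_vertex:
  fixes H :: "nat pair_pre_digraph"
  assumes "r \<ge> 3" "admissible r k H" "rayleigh_ge H \<mu>"
  obtains H' \<nu> where "admissible r (Suc k) (H' :: nat pair_pre_digraph)" "\<nu> > \<mu>" "rayleigh_ge H' \<nu>"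
proof -
  obtain H' p \<nu> z where *: "admissible r (Suc k) (H' :: nat pair_pre_digraph)" "\<nu> > \<mu>" "\<forall>u. z u \<ge> 0"
    "\<exists>u\<in>pverts H'. z u > 0" "adj_form H' z - (z p)\<^sup>2 \<ge> \<nu> * sq_norm H' z"
    using pendant_vertex[OF assms] by metis
  have "adj_form H' z \<ge> \<nu> * sq_norm H' z" using *(5) zero_le_power2[of "z p"] by linarith
  then have "rayleigh_ge H' \<nu>" using * by (auto simp: rayleigh_ge_def)
  with * show ?thesis using that by blast
qed

text \<open>Pendant vertices are added one at a time; of each strict gain only the weak bound is
  kept.\<close>

lemma rayleigh_ge_extend:
  fixes H :: "nat pair_pre_digraph"
  assumes r: "r \<ge> 3" and H: "admissible r k H" "rayleigh_ge H \<mu>" and "k \<le> l"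
  shows "\<exists>H' :: nat pair_pre_digraph. admissible r l H' \<and> rayleigh_ge H' \<mu>"
  using \<open>k \<le> l\<close>
proof (induction l rule: dec_induct)
  case base
  then show ?case using H by blast
next
  case (step l)
  then obtain H' :: "nat pair_pre_digraph" where "admissible r l H'" "rayleigh_ge H' \<mu>" by blast
  from rayleigh_ge_pendant_vertex[OF r this] obtain H'' \<nu> where
    "admissible r (Suc l) (H'' :: nat pair_pre_digraph)" "\<nu> > \<mu>" "rayleigh_ge H'' \<nu>" .
  then show ?case using rayleigh_ge_mono by (metis less_imp_le)
qed

section \<open>Lower bounds for the second eigenvalue from planes of test vectors\<close>

lemma two_dim_le_lambda2:
  assumes "pair_graph G" "card (pverts G) \<ge> 2"
  obtains \<alpha> \<beta> where "\<alpha> \<noteq> 0 \<or> \<beta> \<noteq> 0"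
    "adj_form G (\<lambda>u. \<alpha> * x u + \<beta> * y u) \<le> lambda2 G * sq_norm G (\<lambda>u. \<alpha> * x u + \<beta> * y u)"
proof -
  from adjacency_eigenbasis_exists[OF assms(1)] obtain d e where "adjacency_eigenbasis G d e" by blast
  then interpret adjacency_eigenbasis G d e .
  from two_dim_le_lambda2[OF assms(2)] that show ?thesis by blast
qed

text \<open>One half of the Courant-Fischer principle: the plane contains a nonzero vector with
  Rayleigh quotient at most \<open>lambda2 G\<close>. The assumption \<open>pos\<close> expresses
  that \<open>x\<close> and \<open>y\<close> are linearly independent on the vertices.\<close>

lemma lambda2_ge:
  assumes G: "pair_graph G" "card (pverts G) \<ge> 2"
    and form: "\<And>\<alpha> \<beta>. adj_form G (\<lambda>u. \<alpha> * x u + \<beta> * y u) \<ge> \<mu> * sq_norm G (\<lambda>u. \<alpha> * x u + \<beta> * y u)"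
    and pos: "\<And>\<alpha> \<beta>. \<alpha> \<noteq> 0 \<or> \<beta> \<noteq> 0 \<Longrightarrow> sq_norm G (\<lambda>u. \<alpha> * x u + \<beta> * y u) > 0"
  shows "lambda2 G \<ge> \<mu>"
proof -
  obtain \<alpha> \<beta> where "\<alpha> \<noteq> 0 \<or> \<beta> \<noteq> 0"
    "adj_form G (\<lambda>u. \<alpha> * x u + \<beta> * y u) \<le> lambda2 G * sq_norm G (\<lambda>u. \<alpha> * x u + \<beta> * y u)"
    using two_dim_le_lambda2[OF G] .
  then show ?thesis using form[of \<alpha> \<beta>] pos[of \<alpha> \<beta>] by (meson mult_le_cancel_right_pos order_trans)
qed

text \<open>The two copies of \<open>x\<close>, extended by 0, span the test plane. All these
  vectors vanish at the connecting vertex \<open>w\<close>, so the connecting edges contribute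
  nothing.\<close>

lemma two_copies_through_vertex:
  fixes H :: "nat pair_pre_digraph"
  assumes r: "r \<ge> 3" and H: "admissible r m H" and R: "rayleigh_ge H \<mu>"
  obtains G :: "nat pair_pre_digraph" where "admissible r (2 * m + 1) G" "lambda2 G \<ge> \<mu>"
proof -
  obtain x u where x: "\<forall>u. x u \<ge> 0" "u \<in> pverts H" "x u > 0" "adj_form H x \<ge> \<mu> * sq_norm H x"
    using R by (auto simp: rayleigh_ge_def)
  note HD = admissibleD[OF H]
  obtain w where w: "w \<notin> pverts H" using ex_new_if_finite[OF infinite_UNIV_nat HD(5)] by blast
  obtain f where f: "inj f" "f ` pverts H \<inter> (insert w (pverts H)) = {}"
    using disjoint_copy_exists[of "pverts H" "insert w (pverts H)"] HD(5) by blast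
  let ?C = "map_graph f H"
  have C: "admissible r m ?C" by (rule admissible_map_graph[OF f(1) H])
  note CD = admissibleD[OF C]
  \<comment> \<open>The path from \<open>u\<close> through \<open>w\<close> to \<open>f u\<close>
    arises from two successive bridges, so minor-freeness is preserved twice.\<close>
  interpret L: two_graphs H "single_vertex w" u w
    by (rule two_graphs.intro) (use HD x w in \<open>auto simp: pair_graph_single_vertex\<close>)
  let ?L = "bridge_join H (single_vertex w) u w"
  have La: "admissible r (m + 1) ?L" by (intro L.admissible_bridge_join r H admissible_single_vertex)
  interpret G: two_graphs ?L ?C w "f u"
    by (rule two_graphs.intro)
      (use admissibleD[OF La] CD(1) x f in \<open>auto simp: map_graph_simps bridge_join_simps\<close>)
  let ?G = "bridge_join ?L ?C w (f u)"
  have Ga: "admissible r (2 * m + 1) ?G"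
    using G.admissible_bridge_join[OF r La C] by (simp add: mult_2)
  define x1 where "x1 v = (if v \<in> pverts H then x v else 0)" for v
  define x2 where "x2 v = (if v \<in> f ` pverts H then x (inv_into UNIV f v) else 0)" for v
  have zH: "\<alpha> * x1 v + \<beta> * x2 v = \<alpha> * x v" if "v \<in> pverts H" for \<alpha> \<beta> v
    using that f by (auto simp: x1_def x2_def)
  have zf: "\<alpha> * x1 (f v) + \<beta> * x2 (f v) = \<beta> * x v" if "v \<in> pverts H" for \<alpha> \<beta> v
    using that f by (auto simp: x1_def x2_def)
  have zw: "\<alpha> * x1 w + \<beta> * x2 w = 0" for \<alpha> \<beta>
    using w f by (auto simp: x1_def x2_def)
  have form: "adj_form ?G (\<lambda>v. \<alpha> * x1 v + \<beta> * x2 v) = (\<alpha>\<^sup>2 + \<beta>\<^sup>2) * adj_form H x" (is "adj_form _ ?z = _") for \<alpha> \<beta>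
  proof -
    have "adj_form H ?z = \<alpha>\<^sup>2 * adj_form H x"
      using adj_form_cong[OF HD(1), of ?z "\<lambda>v. \<alpha> * x v"] zH by (simp add: adj_form_scale)
    moreover have "adj_form ?C ?z = \<beta>\<^sup>2 * adj_form H x"
      using adj_form_cong[OF HD(1), of "?z \<circ> f" "\<lambda>v. \<beta> * x v"] zf
      by (simp add: adj_form_map_graph[OF f(1)] adj_form_scale)
    ultimately show ?thesis
      unfolding G.adj_form_bridge_join L.adj_form_bridge_join zw
      by (simp add: adj_form_def[of "single_vertex w"] algebra_simps)
  qed
  have sq: "sq_norm ?G (\<lambda>v. \<alpha> * x1 v + \<beta> * x2 v) = (\<alpha>\<^sup>2 + \<beta>\<^sup>2) * sq_norm H x" (is "sq_norm _ ?z = _") for \<alpha> \<beta>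
  proof -
    have "sq_norm H ?z = \<alpha>\<^sup>2 * sq_norm H x"
      using sq_norm_cong[of H ?z "\<lambda>v. \<alpha> * x v"] zH by (simp add: sq_norm_scale)
    moreover have "sq_norm ?C ?z = \<beta>\<^sup>2 * sq_norm H x"
      using sq_norm_cong[of H "?z \<circ> f" "\<lambda>v. \<beta> * x v"] zf
      by (simp add: sq_norm_map_graph[OF f(1)] sq_norm_scale)
    moreover have "sq_norm (single_vertex w) ?z = 0" using zw by (simp add: sq_norm_def)
    ultimately show ?thesis
      unfolding G.sq_norm_bridge_join L.sq_norm_bridge_join by (simp add: algebra_simps)
  qed
  have sqpos: "sq_norm H x > 0" using sq_norm_pos[OF HD(5) x(2)] x(3) by simp
  have "m \<noteq> 0" using HD(4,5) x(2) by (auto simp: card_gt_0_iff)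
  have "lambda2 ?G \<ge> \<mu>"
  proof (rule lambda2_ge[where x = x1 and y = x2])
    show "pair_graph ?G" using Ga by (simp add: admissible_def)
    show "card (pverts ?G) \<ge> 2" using Ga \<open>m \<noteq> 0\<close> by (simp add: admissible_def)
    show "\<mu> * sq_norm ?G (\<lambda>u. \<alpha> * x1 u + \<beta> * x2 u) \<le> adj_form ?G (\<lambda>u. \<alpha> * x1 u + \<beta> * x2 u)" for \<alpha> \<beta>
      unfolding form sq using mult_left_mono[OF x(4), of "\<alpha>\<^sup>2 + \<beta>\<^sup>2"] by (simp add: mult_ac)
    show "sq_norm ?G (\<lambda>u. \<alpha> * x1 u + \<beta> * x2 u) > 0" if "\<alpha> \<noteq> 0 \<or> \<beta> \<noteq> 0" for \<alpha> \<beta>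
      unfolding sq using sqpos that by (simp add: sum_power2_gt_zero_iff)
  qed
  with Ga that show ?thesis by blast
qed

text \<open>The bridge contributes \<open>2 * \<alpha> * \<beta> * (x p)\<^sup>2\<close>, which may
  be negative; the loop of weight -1 in the assumption pays for the worst case.\<close>

lemma two_copies_bridged:
  fixes H :: "nat pair_pre_digraph"
  assumes r: "r \<ge> 3" and H: "admissible r m H" and p: "p \<in> pverts H"
    and x: "\<exists>u\<in>pverts H. x u > 0" "adj_form H x - (x p)\<^sup>2 \<ge> \<mu> * sq_norm H x"
  obtains G :: "nat pair_pre_digraph" where "admissible r (2 * m) G" "lambda2 G \<ge> \<mu>"
proof -
  note HD = admissibleD[OF H]
  obtain f where f: "inj f" "f ` pverts H \<inter> pverts H = {}"
    using disjoint_copy_exists[of "pverts H" "pverts H"] HD(5) by blast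
  let ?C = "map_graph f H"
  have C: "admissible r m ?C" by (rule admissible_map_graph[OF f(1) H])
  note CD = admissibleD[OF C]
  interpret G: two_graphs H ?C p "f p"
    by (rule two_graphs.intro) (use HD(1) CD(1) p f in \<open>auto simp: map_graph_simps\<close>)
  let ?G = "bridge_join H ?C p (f p)"
  have Ga: "admissible r (2 * m) ?G"
    using G.admissible_bridge_join[OF r H C] by (simp add: mult_2)
  define x1 where "x1 v = (if v \<in> pverts H then x v else 0)" for v
  define x2 where "x2 v = (if v \<in> f ` pverts H then x (inv_into UNIV f v) else 0)" for v
  have zH: "\<alpha> * x1 v + \<beta> * x2 v = \<alpha> * x v" if "v \<in> pverts H" for \<alpha> \<beta> v
    using that f by (auto simp: x1_def x2_def)
  have zf: "\<alpha> * x1 (f v) + \<beta> * x2 (f v) = \<beta> * x v" if "v \<in> pverts H" for \<alpha> \<beta> v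
    using that f by (auto simp: x1_def x2_def)
  have form: "adj_form ?G (\<lambda>v. \<alpha> * x1 v + \<beta> * x2 v) =
      (\<alpha>\<^sup>2 + \<beta>\<^sup>2) * adj_form H x + 2 * \<alpha> * \<beta> * (x p)\<^sup>2" (is "adj_form _ ?z = _") for \<alpha> \<beta>
  proof -
    have "adj_form H ?z = \<alpha>\<^sup>2 * adj_form H x"
      using adj_form_cong[OF HD(1), of ?z "\<lambda>v. \<alpha> * x v"] zH by (simp add: adj_form_scale)
    moreover have "adj_form ?C ?z = \<beta>\<^sup>2 * adj_form H x"
      using adj_form_cong[OF HD(1), of "?z \<circ> f" "\<lambda>v. \<beta> * x v"] zf
      by (simp add: adj_form_map_graph[OF f(1)] adj_form_scale)
    ultimately show ?thesis
      unfolding G.adj_form_bridge_join zH[OF p] zf[OF p] by (simp add: algebra_simps power2_eq_square)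
  qed
  have sq: "sq_norm ?G (\<lambda>v. \<alpha> * x1 v + \<beta> * x2 v) = (\<alpha>\<^sup>2 + \<beta>\<^sup>2) * sq_norm H x" (is "sq_norm _ ?z = _") for \<alpha> \<beta>
  proof -
    have "sq_norm H ?z = \<alpha>\<^sup>2 * sq_norm H x"
      using sq_norm_cong[of H ?z "\<lambda>v. \<alpha> * x v"] zH by (simp add: sq_norm_scale)
    moreover have "sq_norm ?C ?z = \<beta>\<^sup>2 * sq_norm H x"
      using sq_norm_cong[of H "?z \<circ> f" "\<lambda>v. \<beta> * x v"] zf
      by (simp add: sq_norm_map_graph[OF f(1)] sq_norm_scale)
    ultimately show ?thesis
      unfolding G.sq_norm_bridge_join by (simp add: algebra_simps)
  qed
  obtain u where u: "u \<in> pverts H" "x u > 0" using x by blast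
  have sqpos: "sq_norm H x > 0" using sq_norm_pos[OF HD(5) u(1), of x] u(2) by simp
  have "m \<noteq> 0" using HD(4,5) p by (auto simp: card_gt_0_iff)
  have "lambda2 ?G \<ge> \<mu>"
  proof (rule lambda2_ge[where x = x1 and y = x2])
    show "pair_graph ?G" using Ga by (simp add: admissible_def)
    show "card (pverts ?G) \<ge> 2" using Ga \<open>m \<noteq> 0\<close> by (simp add: admissible_def)
    show "\<mu> * sq_norm ?G (\<lambda>u. \<alpha> * x1 u + \<beta> * x2 u) \<le> adj_form ?G (\<lambda>u. \<alpha> * x1 u + \<beta> * x2 u)" for \<alpha> \<beta>
    proof -
      have "\<mu> * ((\<alpha>\<^sup>2 + \<beta>\<^sup>2) * sq_norm H x) \<le> (\<alpha>\<^sup>2 + \<beta>\<^sup>2) * (adj_form H x - (x p)\<^sup>2)"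
        using mult_left_mono[OF x(2), of "\<alpha>\<^sup>2 + \<beta>\<^sup>2"] by (simp add: mult_ac)
      \<comment> \<open>The negative loops at the two copies of \<open>p\<close> equal the bridge
        term minus a square.\<close>
      also have "\<dots> = (\<alpha>\<^sup>2 + \<beta>\<^sup>2) * adj_form H x + 2 * \<alpha> * \<beta> * (x p)\<^sup>2 - (\<alpha> + \<beta>)\<^sup>2 * (x p)\<^sup>2"
        by (simp add: algebra_simps power2_sum)
      also have "\<dots> \<le> (\<alpha>\<^sup>2 + \<beta>\<^sup>2) * adj_form H x + 2 * \<alpha> * \<beta> * (x p)\<^sup>2" by simp
      finally show ?thesis unfolding form sq .
    qed
    show "sq_norm ?G (\<lambda>u. \<alpha> * x1 u + \<beta> * x2 u) > 0" if "\<alpha> \<noteq> 0 \<or> \<beta> \<noteq> 0" for \<alpha> \<beta>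
      unfolding sq using sqpos that by (simp add: sum_power2_gt_zero_iff)
  qed
  with Ga that show ?thesis by blast
qed

section \<open>The extremal graph\<close>

definition pos_part :: "'a pair_pre_digraph \<Rightarrow> ('a \<Rightarrow> real) \<Rightarrow> 'a set" where
  "pos_part G y = {u \<in> pverts G. y u > 0}"

locale lambda2_extremal =
  fixes r n :: nat and G :: "nat pair_pre_digraph" and y :: "nat \<Rightarrow> real"
  assumes r: "r \<ge> 3" and max: "max_lambda2 r n G" and n: "n \<ge> 2"
    and eigenvector: "\<And>u. u \<in> pverts G \<Longrightarrow> (\<Sum>v | (u, v) \<in> parcs G. y v) = lambda2 G * y u"
    and nonempty: "pos_part G y \<noteq> {}" "pos_part G (\<lambda>u. - y u) \<noteq> {}"

text \<open>Negating \<open>y\<close> exchanges the positive and negative parts, so each result on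
  the positive part also holds for the negative one.\<close>

lemma lambda2_extremal_uminus: "lambda2_extremal r n G y \<Longrightarrow> lambda2_extremal r n G (\<lambda>u. - y u)"
  by (simp add: lambda2_extremal_def sum_negf)

section \<open>The sign parts of the eigenvector and the edges between them\<close>

context lambda2_extremal
begin

abbreviation P :: "nat set" where "P \<equiv> pos_part G y"
abbreviation N :: "nat set" where "N \<equiv> pos_part G (\<lambda>u. - y u)"

lemma G: "admissible r n G" "pair_graph G" "cut_connected (pverts G) (parcs G)" "K_minor_free r G"
    "finite (pverts G)" "card (pverts G) = n" "sym (parcs G)" "parcs G \<subseteq> pverts G \<times> pverts G"
  using max by (auto simp: max_lambda2_def admissible_def connected_iff_cut pair_graph_iff)

lemma finite_parcs: "finite (parcs G)"
  using finite_subset[OF G(8)] G(5) by simp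

lemma lambda2_le: "admissible r n G' \<Longrightarrow> lambda2 G' \<le> lambda2 G" for G' :: "nat pair_pre_digraph"
  using max by (auto simp: max_lambda2_def admissible_def connected_iff_cut)

lemma parts: "P \<subseteq> pverts G" "N \<subseteq> pverts G" "P \<inter> N = {}" "finite P" "finite N"
  "\<And>u. u \<in> P \<Longrightarrow> y u > 0" "\<And>u. u \<in> N \<Longrightarrow> y u < 0"
  "\<And>u. u \<in> pverts G \<Longrightarrow> u \<notin> P \<Longrightarrow> u \<notin> N \<Longrightarrow> y u = 0"
  using G(5) by (auto simp: pos_part_def)

text \<open>Arcs are taken only from \<open>C\<close> to \<open>N\<close>, so for
  \<open>C \<subseteq> P\<close> each cross edge counts once; the sign makes its weight
  positive.\<close>

definition cross_weight :: "nat set \<Rightarrow> real" where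
  "cross_weight C = (\<Sum>(u, v)\<in>parcs G \<inter> C \<times> N. - (y u * y v))"

lemma cross_term_pos: "u \<in> P \<Longrightarrow> v \<in> N \<Longrightarrow> - (y u * y v) > 0"
  using parts(6,7) by (simp add: mult_pos_neg)

lemma finite_cross: "finite (parcs G \<inter> C \<times> N)"
  using finite_parcs by simp

lemma cross_weight_nonneg: "C \<subseteq> P \<Longrightarrow> cross_weight C \<ge> 0"
  unfolding cross_weight_def using cross_term_pos by (intro sum_nonneg) (force intro: less_imp_le)

lemma cross_weight_pos: "C \<subseteq> P \<Longrightarrow> parcs G \<inter> C \<times> N \<noteq> {} \<Longrightarrow> cross_weight C > 0"
  unfolding cross_weight_def using cross_term_pos finite_cross by (intro sum_pos) auto

text \<open>The eigenvalue equation on a union \<open>C\<close> of components of the positive part: neighbours outside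
  \<open>C\<close> have weight at most \<open>0\<close>, and dropping them can only increase the quadratic form.\<close>

lemma adj_form_closed:
  assumes C: "C \<subseteq> P" and closed: "parcs G \<inter> C \<times> (P - C) = {}"
  shows "adj_form (induced G C) y = lambda2 G * sq_norm (induced G C) y + cross_weight C"
proof -
  have CG: "C \<subseteq> pverts G" "finite C" using C parts(1,4) finite_subset by blast+
  interpret C: pair_graph "induced G C" using G(2) CG(1) by (rule pair_graph_induced)
  have fin: "finite {v. (u, v) \<in> parcs G}" for u
    using G(5) by (rule finite_subset[rotated]) (use G(8) in auto)
  have nb: "(\<Sum>v | (u, v) \<in> parcs (induced G C). y v) = lambda2 G * y u + (\<Sum>v | v \<in> N \<and> (u, v) \<in> parcs G. - y v)"
    if u: "u \<in> C" for u
  proof -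
    let ?A = "{v. (u, v) \<in> parcs (induced G C)}" and ?B = "{v. v \<in> N \<and> (u, v) \<in> parcs G}"
    have "(\<Sum>v\<in>{v. (u, v) \<in> parcs G}. y v) = (\<Sum>v\<in>?A \<union> ?B. y v)"
    proof (rule sum.mono_neutral_right[OF fin])
      show "?A \<union> ?B \<subseteq> {v. (u, v) \<in> parcs G}" by auto
      show "\<forall>v\<in>{v. (u, v) \<in> parcs G} - (?A \<union> ?B). y v = 0"
      proof
        fix v assume v: "v \<in> {v. (u, v) \<in> parcs G} - (?A \<union> ?B)"
        then have "v \<in> pverts G" "v \<notin> C" "v \<notin> N" using u G(8) by auto
        moreover have "v \<notin> P" using v closed u \<open>v \<notin> C\<close> by blast
        ultimately show "y v = 0" using parts(8) by blast
      qed
    qed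
    also have "\<dots> = (\<Sum>v\<in>?A. y v) + (\<Sum>v\<in>?B. y v)"
      by (rule sum.union_disjoint) (use finite_subset[OF _ fin[of u]] C parts(3) in auto)
    finally show ?thesis using eigenvector[OF subsetD[OF CG(1) u]] by (simp add: sum_negf)
  qed
  have "parcs G \<inter> C \<times> N = (SIGMA u:C. {v. v \<in> N \<and> (u, v) \<in> parcs G})" by auto
  then have "cross_weight C = (\<Sum>u\<in>C. \<Sum>v | v \<in> N \<and> (u, v) \<in> parcs G. - (y u * y v))"
    unfolding cross_weight_def using CG(2) parts(5) by (simp add: sum.Sigma)
  then have cw: "cross_weight C = (\<Sum>u\<in>C. y u * (\<Sum>v | v \<in> N \<and> (u, v) \<in> parcs G. - y v))"
    by (simp add: sum_distrib_left sum_negf)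
  have "adj_form (induced G C) y =
      (\<Sum>u\<in>C. y u * (lambda2 G * y u + (\<Sum>v | v \<in> N \<and> (u, v) \<in> parcs G. - y v)))"
    unfolding C.adj_form_neighbours by (rule sum.cong) (simp, simp only: nb)
  then show ?thesis
    unfolding cw sq_norm_def by (simp add: distrib_left sum.distrib sum_distrib_left power2_eq_square mult_ac)
qed

text \<open>Dividing the identity for the form by the squared norm gives exactly this quotient;
  setting \<open>y\<close> to 0 outside \<open>C\<close> makes the test vector nonnegative
  everywhere.\<close>

lemma rayleigh_closed:
  assumes C: "C \<subseteq> P" "C \<noteq> {}" and closed: "parcs G \<inter> C \<times> (P - C) = {}"
  shows "rayleigh_ge (induced G C) (lambda2 G + cross_weight C / sq_norm (induced G C) y)"
proof -
  define x where "x u = (if u \<in> C then y u else 0)" for u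
  have CG: "C \<subseteq> pverts G" using C parts(1) by blast
  obtain u where u: "u \<in> C" "y u > 0" using C parts(6) by blast
  have pos: "sq_norm (induced G C) y > 0"
    by (rule sq_norm_pos[of _ u]) (use u CG finite_subset[OF CG G(5)] in auto)
  have "adj_form (induced G C) x = adj_form (induced G C) y"
    by (rule adj_form_cong[OF pair_graph_induced[OF G(2) CG]]) (simp add: x_def)
  moreover have "sq_norm (induced G C) x = sq_norm (induced G C) y"
    by (rule sq_norm_cong) (simp add: x_def)
  ultimately have "adj_form (induced G C) x \<ge>
      (lambda2 G + cross_weight C / sq_norm (induced G C) y) * sq_norm (induced G C) x"
    using pos adj_form_closed[OF C(1) closed] by (simp add: distrib_right)
  moreover have "\<forall>u. x u \<ge> 0" "x u > 0" using u C(1) parts(6) by (auto simp: x_def intro: less_imp_le)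
  ultimately show ?thesis unfolding rayleigh_ge_def using u by auto
qed

lemma rayleigh_closed_lambda2:
  assumes "C \<subseteq> P" "C \<noteq> {}" "parcs G \<inter> C \<times> (P - C) = {}"
  shows "rayleigh_ge (induced G C) (lambda2 G)"
proof (rule rayleigh_ge_mono[OF rayleigh_closed[OF assms]])
  have "sq_norm (induced G C) y \<ge> 0" by (simp add: sq_norm_def sum_nonneg)
  then show "lambda2 G \<le> lambda2 G + cross_weight C / sq_norm (induced G C) y"
    using cross_weight_nonneg[OF assms(1)] by simp
qed

subsection \<open>Odd order\<close>

text \<open>Such a graph can be made connected, padded to \<open>m\<close> vertices and doubled
  through a new vertex, which gives a competitor on \<open>n\<close> vertices.\<close>

lemma odd_no_better_half:
  fixes H :: "nat pair_pre_digraph"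
  assumes "n = 2 * m + 1" and H: "pair_graph H" "K_minor_free r H" "card (pverts H) \<le> m"
    and R: "rayleigh_ge H \<nu>"
  shows "\<nu> \<le> lambda2 G"
proof -
  obtain H1 :: "nat pair_pre_digraph" where "admissible r (card (pverts H)) H1" "rayleigh_ge H1 \<nu>"
    using rayleigh_connected_supergraph[OF r H(1,2) R] .
  from rayleigh_ge_extend[OF r this H(3)] obtain H2 :: "nat pair_pre_digraph"
    where "admissible r m H2" "rayleigh_ge H2 \<nu>" by blast
  from two_copies_through_vertex[OF r this] obtain G' :: "nat pair_pre_digraph"
    where "admissible r (2 * m + 1) G'" "lambda2 G' \<ge> \<nu>" .
  with lambda2_le[of G'] assms(1) show ?thesis by simp
qed

text \<open>A smaller positive part leaves room for a pendant vertex, which pushes the Rayleigh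
  quotient strictly above \<open>lambda2 G\<close>.\<close>

lemma odd_card_pos_part:
  assumes nm: "n = 2 * m + 1"
  shows "card P \<ge> m"
proof (rule ccontr)
  assume small: "\<not> card P \<ge> m"
  have "rayleigh_ge (induced G P) (lambda2 G)" using nonempty by (intro rayleigh_closed_lambda2) auto
  then obtain H1 :: "nat pair_pre_digraph" where "admissible r (card P) H1" "rayleigh_ge H1 (lambda2 G)"
    using rayleigh_connected_supergraph[OF r pair_graph_induced[OF G(2) parts(1)]
        K_minor_free_induced[OF G(2) parts(1) G(4)]] by auto
  from rayleigh_ge_pendant_vertex[OF r this] obtain H2 \<nu> where
    H2: "admissible r (Suc (card P)) (H2 :: nat pair_pre_digraph)" "\<nu> > lambda2 G" "rayleigh_ge H2 \<nu>" .
  with odd_no_better_half[OF nm, of H2 \<nu>] small show False by (auto simp: admissible_def)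
qed

text \<open>Cross edges would make the quotient of the positive part strictly larger than
  \<open>lambda2 G\<close>.\<close>

lemma odd_no_cross:
  assumes nm: "n = 2 * m + 1" and "card P = m"
  shows "parcs G \<inter> P \<times> N = {}"
proof (rule ccontr)
  assume "parcs G \<inter> P \<times> N \<noteq> {}"
  then have "cross_weight P > 0" using cross_weight_pos by blast
  moreover obtain u where "u \<in> P" using nonempty by blast
  then have "sq_norm (induced G P) y > 0"
    using sq_norm_pos[of "induced G P" u y] parts(4) parts(6)[of u] by auto
  ultimately have "lambda2 G + cross_weight P / sq_norm (induced G P) y > lambda2 G" by simp
  moreover have "rayleigh_ge (induced G P) (lambda2 G + cross_weight P / sq_norm (induced G P) y)"
    using nonempty by (intro rayleigh_closed) auto
  ultimately show False
    using odd_no_better_half[OF nm pair_graph_induced[OF G(2) parts(1)]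
        K_minor_free_induced[OF G(2) parts(1) G(4)]] assms(2) by fastforce
qed

text \<open>\<open>lambda2 G\<close> separates the radii: doubling bounds that of every competitor
  \<open>A'\<close> by \<open>lambda2 G\<close>, while the eigenvector shows that the half of
  \<open>G\<close> reaches \<open>lambda2 G\<close>.\<close>

lemma odd_Gstar:
  assumes nm: "n = 2 * m + 1" and "card P = m"
  shows "is_Gstar r m (induced G P)"
  unfolding is_Gstar_def
proof (intro conjI allI impI)
  show pg: "pair_graph (induced G P)" and "K_minor_free r (induced G P)" "card (pverts (induced G P)) = m"
    using pair_graph_induced[OF G(2) parts(1)] K_minor_free_induced[OF G(2) parts(1) G(4)] assms by auto
  fix A' :: "nat pair_pre_digraph"
  assume A': "pair_graph A' \<and> card (pverts A') = m \<and> K_minor_free r A'"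
  obtain d e where "adjacency_eigenbasis A' d e" using adjacency_eigenbasis_exists A' by blast
  then interpret A': adjacency_eigenbasis A' d e .
  have "m > 0" using assms(2) nonempty parts(4) by (auto simp: card_gt_0_iff)
  then have "pverts A' \<noteq> {}" using A' by auto
  from A'.spectral_radius_attained[OF this] obtain x where x: "\<forall>u. x u \<ge> 0" "sq_norm A' x = 1"
    "adj_form A' x \<ge> graph_spectral_radius A'" .
  have "\<exists>u\<in>pverts A'. x u > 0"
  proof (rule ccontr)
    assume "\<not> ?thesis"
    then have "\<forall>u\<in>pverts A'. x u = 0" using x(1) by (simp add: order_antisym not_less)
    then have "sq_norm A' x = 0" by (simp add: sq_norm_def)
    with x(2) show False by simp
  qed
  then have ray: "rayleigh_ge A' (graph_spectral_radius A')" unfolding rayleigh_ge_def using x by auto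
  have le: "graph_spectral_radius A' \<le> lambda2 G"
    by (rule odd_no_better_half[OF nm _ _ _ ray]) (use A' in simp_all)
  have "rayleigh_ge (induced G P) (lambda2 G)" using nonempty by (intro rayleigh_closed_lambda2) auto
  then obtain z where z: "\<exists>u\<in>P. z u > 0" "adj_form (induced G P) z \<ge> lambda2 G * sq_norm (induced G P) z"
    by (auto simp: rayleigh_ge_def)
  obtain d e where "adjacency_eigenbasis (induced G P) d e" using adjacency_eigenbasis_exists[OF pg] by blast
  then interpret E: adjacency_eigenbasis "induced G P" d e .
  have "sq_norm (induced G P) z > 0" using z(1) sq_norm_pos[of "induced G P" _ z] parts(4) by fastforce
  moreover have "lambda2 G * sq_norm (induced G P) z \<le> graph_spectral_radius (induced G P) * sq_norm (induced G P) z"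
    using z(2) E.adj_form_le_spectral_radius[of z] by linarith
  ultimately have "lambda2 G \<le> graph_spectral_radius (induced G P)" by simp
  with le show "graph_spectral_radius A' \<le> graph_spectral_radius (induced G P)" by linarith
qed

end

lemma odd_case:
  assumes L: "lambda2_extremal r n G y" and nm: "n = 2 * m + 1"
  shows "\<exists>A B. is_Gstar r m A \<and> is_Gstar r m B \<and> pverts A \<inter> pverts B = {} \<and> G \<in> I_family A B"
proof -
  interpret lambda2_extremal r n G y by fact
  interpret neg: lambda2_extremal r n G "\<lambda>u. - y u" using L by (rule lambda2_extremal_uminus)
  have sub: "P \<union> N \<subseteq> pverts G" and disj: "P \<inter> N = {}" using parts by auto
  have cPN: "card (P \<union> N) = card P + card N" using parts by (simp add: card_Un_disjoint)
  have le: "card P + card N \<le> 2 * m + 1" using card_mono[OF G(5) sub] cPN G(6) nm by simp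
  have cP: "card P \<ge> m" and cN: "card N \<ge> m" using odd_card_pos_part[OF nm] neg.odd_card_pos_part[OF nm] by auto
  have no: "(u, v) \<notin> parcs G" if "u \<in> P" "v \<in> N" for u v
  \<comment> \<open>Both parts have at least \<open>m\<close> of the \<open>2 * m + 1\<close>
    vertices, so at least one has exactly \<open>m\<close>; cross edges are excluded from that
    side.\<close>
  proof (cases "card P = m")
    case True
    then show ?thesis using odd_no_cross[OF nm] that by blast
  next
    case False
    then have "card N = m" using le cP cN by simp
    from neg.odd_no_cross[OF nm this] have "parcs G \<inter> N \<times> P = {}" by simp
    then show ?thesis using that symD[OF G(7), of u v] by blast
  qed
  \<comment> \<open>Without cross edges, connectedness needs a vertex where \<open>y\<close>
    vanishes. Counting then leaves exactly one, the vertex \<open>w\<close> of the family.\<close>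
  have "P \<union> N \<noteq> pverts G"
  proof
    assume V: "P \<union> N = pverts G"
    have "P \<subseteq> pverts G" "P \<noteq> {}" "P \<noteq> pverts G" using nonempty disj V by auto
    from cut_connectedD[OF G(3) this] obtain u v where "u \<in> P" "v \<in> pverts G" "v \<notin> P" "(u, v) \<in> parcs G" .
    with no V show False by blast
  qed
  then have "card (P \<union> N) < card (pverts G)" using sub G(5) by (meson psubsetI psubset_card_mono)
  then have cards: "card P = m" "card N = m" using cPN cP cN G(6) nm by auto
  have "card (pverts G - (P \<union> N)) = 1"
    using card_Diff_subset[of "P \<union> N" "pverts G"] sub cPN cards G(6) nm parts(4,5) by simp
  then obtain w where w: "pverts G - (P \<union> N) = {w}" by (auto simp: card_1_singleton_iff)
  define S where "S = {u \<in> P. (w, u) \<in> parcs G}"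
  define T where "T = {u \<in> N. (w, u) \<in> parcs G}"
  let ?J = "join_new_vertex (graph_union (induced G P) (induced G N)) w (S \<union> T)"
  have V: "pverts G = insert w (P \<union> N)" and wPN: "w \<notin> P \<union> N" using w sub by auto
  have loop: "(w, w) \<notin> parcs G" using G(2) by (simp add: pair_graph_iff)
  have "parcs ?J = parcs G"
  proof (rule Set.set_eqI)
    fix e :: "nat \<times> nat"
    obtain u v where e: "e = (u, v)" by (cases e)
    have sy: "(u, v) \<in> parcs G \<longleftrightarrow> (v, u) \<in> parcs G" using G(7) by (auto dest: symD)
    have "(u, v) \<in> parcs ?J \<longleftrightarrow> (u, v) \<in> parcs G"
    proof
      assume "(u, v) \<in> parcs ?J"
      then show "(u, v) \<in> parcs G" using sy by (auto simp: join_new_vertex_def graph_union_def S_def T_def)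
    next
      assume uv: "(u, v) \<in> parcs G"
      then have "u \<in> insert w (P \<union> N)" "v \<in> insert w (P \<union> N)" using G(8) V by auto
      then show "(u, v) \<in> parcs ?J" using uv sy no[of u v] no[of v u] loop
        by (auto simp: join_new_vertex_def graph_union_def S_def T_def)
    qed
    then show "e \<in> parcs ?J \<longleftrightarrow> e \<in> parcs G" using e by simp
  qed
  moreover have "pverts ?J = pverts G" using V by (simp add: join_new_vertex_def graph_union_def)
  ultimately have J: "?J = G" by simp
  have "Digraph_Component.connected (with_proj G)" using G(2,3) by (simp add: connected_iff_cut)
  then have "G \<in> I_family (induced G P) (induced G N)"
    unfolding I_family_def mem_Collect_eq using J wPN
    by (intro exI[of _ w] exI[of _ S] exI[of _ T]) (auto simp: S_def T_def)
  moreover have "is_Gstar r m (induced G P)" "is_Gstar r m (induced G N)"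
    using odd_Gstar[OF nm cards(1)] neg.odd_Gstar[OF nm cards(2)] by auto
  ultimately show ?thesis using disj by (metis induced_simps(1))
qed

context lambda2_extremal
begin

subsection \<open>Even order\<close>

text \<open>The bound applies to unions of components of \<open>P\<close>, not just to
  \<open>P\<close>. If it failed, padding to \<open>m - 1\<close> vertices, adding a pendant vertex
  \<open>p\<close> and bridging two copies at \<open>p\<close> would beat
  \<open>lambda2 G\<close>.\<close>

lemma even_card_closed:
  assumes nm: "n = 2 * m" and C: "C \<subseteq> P" "C \<noteq> {}" and closed: "parcs G \<inter> C \<times> (P - C) = {}"
  shows "card C \<ge> m"
proof (rule ccontr)
  assume "\<not> card C \<ge> m"
  then obtain k where k: "m = Suc k" "card C \<le> k" by (cases m) auto
  have CG: "C \<subseteq> pverts G" using C parts(1) by blast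
  obtain H1 :: "nat pair_pre_digraph" where "admissible r (card C) H1" "rayleigh_ge H1 (lambda2 G)"
    using rayleigh_connected_supergraph[OF r pair_graph_induced[OF G(2) CG]
        K_minor_free_induced[OF G(2) CG G(4)] rayleigh_closed_lambda2[OF C closed]] by auto
  from rayleigh_ge_extend[OF r this k(2)] obtain H2 :: "nat pair_pre_digraph"
    where "admissible r k H2" "rayleigh_ge H2 (lambda2 G)" by blast
  from pendant_vertex[OF r this] obtain H3 :: "nat pair_pre_digraph" and p \<nu> z where
    H3: "admissible r m H3" "p \<in> pverts H3" "\<nu> > lambda2 G" "\<forall>u. z u \<ge> 0"
      "\<exists>u\<in>pverts H3. z u > 0" "adj_form H3 z - (z p)\<^sup>2 \<ge> \<nu> * sq_norm H3 z"
    unfolding k(1) .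
  from two_copies_bridged[OF r H3(1,2,5,6)] obtain G' :: "nat pair_pre_digraph"
    where "admissible r (2 * m) G'" "lambda2 G' \<ge> \<nu>" .
  with lambda2_le[of G'] nm H3(3) show False by simp
qed

text \<open>A proper nonempty union of components would already contain \<open>m\<close> vertices,
  that is, all of \<open>P\<close>.\<close>

lemma even_cut_connected:
  assumes nm: "n = 2 * m" and "card P = m"
  shows "cut_connected P (parcs G \<inter> P \<times> P)"
  unfolding cut_connected_def
proof (intro conjI allI impI notI)
  show "P = {} \<Longrightarrow> False" using nonempty by simp
  fix S assume S: "S \<subseteq> P \<and> S \<noteq> {} \<and> S \<noteq> P" and "parcs G \<inter> P \<times> P \<inter> S \<times> (P - S) = {}"
  then have "parcs G \<inter> S \<times> (P - S) = {}" by blast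
  with even_card_closed[OF nm] S have "card S \<ge> card P" using assms(2) by blast
  then show False using S parts(4) by (metis card_seteq)
qed

text \<open>The two halves joined by a single edge are again a candidate for the maximum; the test space is
  spanned by the positive and the negative part of \<open>y\<close>.\<close>

lemma even_compare:
  fixes H1 H2 :: "nat pair_pre_digraph"
  assumes nm: "n = 2 * m" and H1: "admissible r m H1" "pverts H1 = P" and H2: "admissible r m H2" "pverts H2 = N"
    and ab: "a \<in> P" "b \<in> N"
  obtains \<alpha> \<beta> where "\<alpha> \<noteq> 0 \<or> \<beta> \<noteq> 0"
    "\<alpha>\<^sup>2 * adj_form H1 y + \<beta>\<^sup>2 * adj_form H2 y + 2 * \<alpha> * \<beta> * (y a * y b) \<le>
      lambda2 G * (\<alpha>\<^sup>2 * sq_norm H1 y + \<beta>\<^sup>2 * sq_norm H2 y)"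
proof -
  interpret B: two_graphs H1 H2 a b
    by (rule two_graphs.intro) (use H1 H2 ab parts(3) in \<open>auto simp: admissible_def\<close>)
  let ?B = "bridge_join H1 H2 a b"
  have B: "admissible r n ?B" using B.admissible_bridge_join[OF r H1(1) H2(1)] by (simp add: nm mult_2)
  define y1 where "y1 u = (if u \<in> P then y u else 0)" for u
  define y2 where "y2 u = (if u \<in> N then y u else 0)" for u
  have z1: "\<alpha> * y1 u + \<beta> * y2 u = \<alpha> * y u" if "u \<in> P" for \<alpha> \<beta> u
    using that parts(3) by (auto simp: y1_def y2_def)
  have z2: "\<alpha> * y1 u + \<beta> * y2 u = \<beta> * y u" if "u \<in> N" for \<alpha> \<beta> u
    using that parts(3) by (auto simp: y1_def y2_def)
  have "pair_graph ?B" "card (pverts ?B) \<ge> 2" using B n by (auto simp: admissible_def)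
  from two_dim_le_lambda2[OF this, where x = y1 and y = y2] obtain \<alpha> \<beta> where nz: "\<alpha> \<noteq> 0 \<or> \<beta> \<noteq> 0"
    and le: "adj_form ?B (\<lambda>u. \<alpha> * y1 u + \<beta> * y2 u) \<le> lambda2 ?B * sq_norm ?B (\<lambda>u. \<alpha> * y1 u + \<beta> * y2 u)"
    by metis
  let ?z = "\<lambda>u. \<alpha> * y1 u + \<beta> * y2 u"
  have pg: "pair_graph H1" "pair_graph H2" using H1 H2 by (simp_all add: admissible_def)
  have "adj_form H1 ?z = \<alpha>\<^sup>2 * adj_form H1 y" "sq_norm H1 ?z = \<alpha>\<^sup>2 * sq_norm H1 y"
    using adj_form_cong[OF pg(1), of ?z "\<lambda>u. \<alpha> * y u"] sq_norm_cong[of H1 ?z "\<lambda>u. \<alpha> * y u"] z1 H1(2)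
    by (simp_all add: adj_form_scale sq_norm_scale)
  moreover have "adj_form H2 ?z = \<beta>\<^sup>2 * adj_form H2 y" "sq_norm H2 ?z = \<beta>\<^sup>2 * sq_norm H2 y"
    using adj_form_cong[OF pg(2), of ?z "\<lambda>u. \<beta> * y u"] sq_norm_cong[of H2 ?z "\<lambda>u. \<beta> * y u"] z2 H2(2)
    by (simp_all add: adj_form_scale sq_norm_scale)
  ultimately have form: "adj_form ?B ?z =
      \<alpha>\<^sup>2 * adj_form H1 y + \<beta>\<^sup>2 * adj_form H2 y + 2 * \<alpha> * \<beta> * (y a * y b)"
    and sq: "sq_norm ?B ?z = \<alpha>\<^sup>2 * sq_norm H1 y + \<beta>\<^sup>2 * sq_norm H2 y"
    unfolding B.adj_form_bridge_join B.sq_norm_bridge_join z1[OF ab(1)] z2[OF ab(2)] by simp_all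
  have "lambda2 ?B * sq_norm ?B ?z \<le> lambda2 G * sq_norm ?B ?z"
    using lambda2_le[OF B] by (intro mult_right_mono) (auto simp: sq_norm_def sum_nonneg)
  with le have "adj_form ?B ?z \<le> lambda2 G * sq_norm ?B ?z" by linarith
  then show ?thesis using that[OF nz] unfolding form sq by simp
qed

end

lemma adj_form_add_edge:
  assumes "pair_graph H" "u \<noteq> v" "(u, v) \<notin> parcs H"
  shows "adj_form (add_edge H u v) x = adj_form H x + 2 * x u * x v"
proof -
  have "finite (parcs H)" "(v, u) \<notin> parcs H"
    using assms finite_subset[of "parcs H" "pverts H \<times> pverts H"] by (auto simp: pair_graph_iff dest: symD)
  then show ?thesis using assms by (simp add: adj_form_def add_edge_def)
qed

lemma adj_form_uminus: "adj_form H (\<lambda>u. - x u) = adj_form H x"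
  by (simp add: adj_form_def)

lemma sq_norm_uminus: "sq_norm H (\<lambda>u. - x u) = sq_norm H x"
  by (simp add: sq_norm_def)

lemma pair_graph_add_edge:
  "pair_graph H \<Longrightarrow> u \<in> pverts H \<Longrightarrow> v \<in> pverts H \<Longrightarrow> u \<noteq> v \<Longrightarrow> pair_graph (add_edge H u v)"
  by (auto simp: pair_graph_iff add_edge_def sym_def)

text \<open>Counting forces both parts to have \<open>m\<close> vertices and to cover
  \<open>G\<close>. Keeping just one cross edge and comparing with \<open>G\<close> shows that this
  edge carries the whole cross weight.\<close>

lemma even_structure:
  assumes L: "lambda2_extremal r n G y" and nm: "n = 2 * m"
  defines "H1 \<equiv> induced G (pos_part G y)" and "H2 \<equiv> induced G (pos_part G (\<lambda>u. - y u))"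
  obtains a b where "admissible r m H1" "admissible r m H2"
    "pos_part G y \<union> pos_part G (\<lambda>u. - y u) = pverts G" "a \<in> pverts H1" "b \<in> pverts H2"
    "parcs G \<inter> pos_part G y \<times> pos_part G (\<lambda>u. - y u) = {(a, b)}"
    "adj_form H1 y = lambda2 G * sq_norm H1 y - y a * y b"
    "adj_form H2 y = lambda2 G * sq_norm H2 y - y a * y b"
proof -
  interpret lambda2_extremal r n G y by fact
  interpret neg: lambda2_extremal r n G "\<lambda>u. - y u" using L by (rule lambda2_extremal_uminus)
  have negN: "neg.N = P" by simp
  have sub: "P \<union> N \<subseteq> pverts G" and disj: "P \<inter> N = {}" using parts by auto
  have cPN: "card (P \<union> N) = card P + card N" using parts by (simp add: card_Un_disjoint)
  have le: "card P + card N \<le> 2 * m" using card_mono[OF G(5) sub] cPN G(6) nm by simp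
  have "card P \<ge> m" "card N \<ge> m"
    using even_card_closed[OF nm, of P] neg.even_card_closed[OF nm, of N] nonempty by auto
  then have cards: "card P = m" "card N = m" using le by auto
  have V: "P \<union> N = pverts G" using card_subset_eq[OF G(5) sub] cPN cards G(6) nm by simp
  have adm: "admissible r m H1" "admissible r m H2"
    using even_cut_connected[OF nm cards(1)] neg.even_cut_connected[OF nm cards(2)] cards
      pair_graph_induced[OF G(2)] K_minor_free_induced[OF G(2) _ G(4)] parts(1,2)
    by (simp_all add: admissible_def H1_def H2_def)
  have "P \<subseteq> pverts G" "P \<noteq> {}" "P \<noteq> pverts G" using nonempty disj V by auto
  from cut_connectedD[OF G(3) this] obtain a b where "a \<in> P" "b \<in> pverts G" "b \<notin> P" "(a, b) \<in> parcs G" .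
  then have ab: "a \<in> P" "b \<in> N" "(a, b) \<in> parcs G" using V by blast+
  define t where "t = - (y a * y b)"
  have t: "t > 0" unfolding t_def by (rule cross_term_pos[OF ab(1,2)])
  let ?c = "cross_weight P"
  have F1: "adj_form H1 y = lambda2 G * sq_norm H1 y + ?c"
    unfolding H1_def by (rule adj_form_closed) auto
  have "adj_form H2 (\<lambda>u. - y u) = lambda2 G * sq_norm H2 (\<lambda>u. - y u) + neg.cross_weight N"
    unfolding H2_def by (rule neg.adj_form_closed) auto
  \<comment> \<open>The same edges are summed with their arcs reversed.\<close>
  moreover have "neg.cross_weight N = ?c"
    unfolding neg.cross_weight_def cross_weight_def negN
    by (rule sum.reindex_bij_witness[of _ prod.swap prod.swap]) (use G(7) in \<open>auto dest: symD\<close>)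
  ultimately have F2: "adj_form H2 y = lambda2 G * sq_norm H2 y + ?c"
    by (simp add: adj_form_uminus sq_norm_uminus)
  have "t \<le> ?c"
    unfolding cross_weight_def t_def
    using member_le_sum[of "(a, b)" "parcs G \<inter> P \<times> N" "\<lambda>(u, v). - (y u * y v)"]
      ab finite_cross[of P] cross_term_pos by (force intro: less_imp_le)
  \<comment> \<open>For the graph with the single cross edge \<open>ab\<close>, the comparison gives
    \<open>?c * (\<alpha>\<^sup>2 + \<beta>\<^sup>2) \<le> 2 * \<alpha> * \<beta> * t\<close>, and
    the right-hand side is at most \<open>t * (\<alpha>\<^sup>2 + \<beta>\<^sup>2)\<close>.\<close>
  moreover have "?c \<le> t"
  proof -
    obtain \<alpha> \<beta> where nz: "\<alpha> \<noteq> 0 \<or> \<beta> \<noteq> 0"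
      and le: "\<alpha>\<^sup>2 * adj_form H1 y + \<beta>\<^sup>2 * adj_form H2 y + 2 * \<alpha> * \<beta> * (y a * y b) \<le>
        lambda2 G * (\<alpha>\<^sup>2 * sq_norm H1 y + \<beta>\<^sup>2 * sq_norm H2 y)"
      using even_compare[OF nm adm(1) _ adm(2) _ ab(1,2)] by (auto simp: H1_def H2_def)
    have "?c * (\<alpha>\<^sup>2 + \<beta>\<^sup>2) \<le> 2 * \<alpha> * \<beta> * t"
      using le unfolding F1 F2 t_def by (simp add: algebra_simps)
    also have "\<dots> = t * (\<alpha>\<^sup>2 + \<beta>\<^sup>2) - t * (\<alpha> - \<beta>)\<^sup>2"
      by (simp add: power2_diff algebra_simps)
    also have "\<dots> \<le> t * (\<alpha>\<^sup>2 + \<beta>\<^sup>2)" using t by simp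
    finally show ?thesis using nz by (simp add: sum_power2_gt_zero_iff)
  qed
  ultimately have ct: "?c = t" by simp
  have "parcs G \<inter> P \<times> N = {(a, b)}"
  proof (rule ccontr)
    assume "parcs G \<inter> P \<times> N \<noteq> {(a, b)}"
    then have ne: "parcs G \<inter> P \<times> N - {(a, b)} \<noteq> {}" using ab by blast
    have "?c = t + (\<Sum>(u, v)\<in>parcs G \<inter> P \<times> N - {(a, b)}. - (y u * y v))"
      unfolding cross_weight_def t_def using ab finite_cross[of P]
      by (subst sum.remove[of _ "(a, b)"]) auto
    moreover have "(\<Sum>(u, v)\<in>parcs G \<inter> P \<times> N - {(a, b)}. - (y u * y v)) > 0"
      using ne finite_cross[of P] cross_term_pos by (intro sum_pos) auto
    ultimately show False using ct by simp
  qed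
  then show ?thesis
    using that[of a b] adm V ab F1 F2 by (simp add: ct t_def H1_def H2_def)
qed

text \<open>An extra edge \<open>uv\<close> inside \<open>P\<close> adds
  \<open>2 * y u * y v > 0\<close> to the form. If it created no minor, the enlarged half would give
  a competitor contradicting the comparison with \<open>G\<close>.\<close>

lemma even_saturated:
  assumes L: "lambda2_extremal r n G y" and nm: "n = 2 * m"
  shows "K_minor_saturated r (induced G (pos_part G y))"
proof -
  interpret lambda2_extremal r n G y by fact
  let ?H1 = "induced G P" and ?H2 = "induced G N"
  obtain a b where adm: "admissible r m ?H1" "admissible r m ?H2" and ab: "a \<in> P" "b \<in> N"
    and F1: "adj_form ?H1 y = lambda2 G * sq_norm ?H1 y - y a * y b"
    and F2: "adj_form ?H2 y = lambda2 G * sq_norm ?H2 y - y a * y b"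
    using even_structure[OF L nm] by (metis induced_simps(1))
  have "\<not> K_minor_free r (add_edge ?H1 u v)"
    if uv: "u \<in> P" "v \<in> P" "u \<noteq> v" "(u, v) \<notin> parcs ?H1" for u v
  proof
    assume free: "K_minor_free r (add_edge ?H1 u v)"
    let ?H = "add_edge ?H1 u v"
    have pg: "pair_graph ?H1" using adm(1) by (simp add: admissible_def)
    have "cut_connected P (parcs ?H)"
      using cut_connected_mono[of P "parcs ?H1" "parcs ?H"] admissibleD(2)[OF adm(1)]
      by (simp add: add_edge_def subset_insertI2)
    then have H: "admissible r m ?H" "pverts ?H = P"
      using free pair_graph_add_edge[OF pg, of u v] uv admissibleD(4)[OF adm(1)]
      by (auto simp: admissible_def add_edge_def)
    define t where "t = - (y a * y b)"
    define s where "s = 2 * y u * y v"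
    have t: "t > 0" unfolding t_def by (rule cross_term_pos[OF ab])
    have s: "s > 0" using uv parts(6) by (simp add: s_def)
    have F: "adj_form ?H y = lambda2 G * sq_norm ?H1 y + t + s"
      using adj_form_add_edge[OF pg uv(3,4)] F1 by (simp add: s_def t_def)
    have sq: "sq_norm ?H y = sq_norm ?H1 y" by (simp add: sq_norm_def add_edge_def)
    obtain \<alpha> \<beta> where nz: "\<alpha> \<noteq> 0 \<or> \<beta> \<noteq> 0"
      and le: "\<alpha>\<^sup>2 * adj_form ?H y + \<beta>\<^sup>2 * adj_form ?H2 y + 2 * \<alpha> * \<beta> * (y a * y b) \<le>
        lambda2 G * (\<alpha>\<^sup>2 * sq_norm ?H y + \<beta>\<^sup>2 * sq_norm ?H2 y)"
      using even_compare[OF nm H adm(2) _ ab] by auto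
    \<comment> \<open>The excess of the form is a sum of two nonnegative terms; both vanish only if
      \<alpha> = 0 and \<alpha> = \<beta>, which \<open>nz\<close> excludes.\<close>
    have "\<alpha>\<^sup>2 * s + t * (\<alpha> - \<beta>)\<^sup>2 = \<alpha>\<^sup>2 * adj_form ?H y + \<beta>\<^sup>2 * adj_form ?H2 y + 2 * \<alpha> * \<beta> * (y a * y b)
        - lambda2 G * (\<alpha>\<^sup>2 * sq_norm ?H y + \<beta>\<^sup>2 * sq_norm ?H2 y)"
      unfolding F F2 sq by (simp add: t_def power2_diff algebra_simps)
    with le have z: "\<alpha>\<^sup>2 * s + t * (\<alpha> - \<beta>)\<^sup>2 \<le> 0" by simp
    have nn: "\<alpha>\<^sup>2 * s \<ge> 0" "t * (\<alpha> - \<beta>)\<^sup>2 \<ge> 0" using s t by simp_all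
    then have "\<alpha>\<^sup>2 * s = 0" "t * (\<alpha> - \<beta>)\<^sup>2 = 0" using z by linarith+
    with s t nz show False by simp
  qed
  moreover have "K_minor_free r ?H1" by (rule admissibleD(3)[OF adm(1)])
  ultimately show ?thesis unfolding K_minor_saturated_def by simp
qed

text \<open>The unique cross edge exhibits \<open>G\<close> as a bridge join of the halves;
  saturation of the negative half follows by replacing \<open>y\<close> with its negative.\<close>

lemma even_case:
  assumes L: "lambda2_extremal r n G y" and nm: "n = 2 * m"
  shows "\<exists>H1 H2. pair_graph H1 \<and> pair_graph H2 \<and> card (pverts H1) = m \<and> card (pverts H2) = m \<and>
    K_minor_saturated r H1 \<and> K_minor_saturated r H2 \<and> pverts H1 \<inter> pverts H2 = {} \<and> G \<in> E_family H1 H2"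
proof -
  interpret lambda2_extremal r n G y by fact
  let ?H1 = "induced G P" and ?H2 = "induced G N"
  obtain a b where adm: "admissible r m ?H1" "admissible r m ?H2" and ab: "a \<in> P" "b \<in> N"
    and V: "P \<union> N = pverts G" and cross: "parcs G \<inter> P \<times> N = {(a, b)}"
    using even_structure[OF L nm] by (metis induced_simps(1))
  have sat: "K_minor_saturated r ?H1" "K_minor_saturated r ?H2"
    using even_saturated[OF L nm] even_saturated[OF lambda2_extremal_uminus[OF L] nm] by auto
  let ?B = "bridge_join ?H1 ?H2 a b"
  have R: "(u, v) \<in> parcs G \<longleftrightarrow> (v, u) \<in> parcs G" for u v using G(7) by (auto dest: symD)
  have c: "u = a \<and> v = b" if "(u, v) \<in> parcs G" "u \<in> P" "v \<in> N" for u v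
    using that cross by blast
  have abG: "(a, b) \<in> parcs G" using cross by blast
  have "(u, v) \<in> parcs ?B \<longleftrightarrow> (u, v) \<in> parcs G" for u v
  proof
    assume "(u, v) \<in> parcs ?B"
    then show "(u, v) \<in> parcs G" using abG R by (auto simp: bridge_join_simps)
  next
    assume uv: "(u, v) \<in> parcs G"
    then have "u \<in> P \<union> N" "v \<in> P \<union> N" using G(8) V by auto
    then show "(u, v) \<in> parcs ?B" using uv c[of u v] c[of v u] R by (auto simp: bridge_join_simps)
  qed
  then have "parcs ?B = parcs G" by auto
  moreover have "pverts ?B = pverts G" using V by (simp add: bridge_join_simps)
  ultimately have "?B = G" by simp
  then have "G \<in> E_family ?H1 ?H2" unfolding E_family_def using ab by force
  then show ?thesis using adm sat parts(3) unfolding admissible_def by (metis induced_simps(1))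
qed

section \<open>The two parities combined\<close>

theorem theorem3p18:
  fixes r :: nat
  assumes "r \<ge> 3"
  shows "\<exists>N. \<forall>n \<ge> N. \<forall>G :: nat pair_pre_digraph. max_lambda2 r n G \<longrightarrow>
    (odd n \<longrightarrow>
      (\<exists>A B. is_Gstar r ((n - 1) div 2) A \<and> is_Gstar r ((n - 1) div 2) B \<and>
        pverts A \<inter> pverts B = {} \<and> G \<in> I_family A B)) \<and>
    (even n \<longrightarrow>
      (\<exists>H1 H2. pair_graph H1 \<and> pair_graph H2 \<and>
        card (pverts H1) = n div 2 \<and> card (pverts H2) = n div 2 \<and>
        K_minor_saturated r H1 \<and> K_minor_saturated r H2 \<and>
        pverts H1 \<inter> pverts H2 = {} \<and> G \<in> E_family H1 H2))"
\<comment> \<open>The threshold 2 guarantees that a second eigenvalue exists.\<close>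
proof (intro exI[of _ 2] allI impI)
  fix n :: nat and G :: "nat pair_pre_digraph"
  assume n: "n \<ge> 2" and max: "max_lambda2 r n G"
  then have G: "pair_graph G" "card (pverts G) = n" "cut_connected (pverts G) (parcs G)"
    by (auto simp: max_lambda2_def connected_iff_cut)
  from adjacency_eigenbasis_exists[OF G(1)] obtain d e where "adjacency_eigenbasis G d e" by blast
  then interpret adjacency_eigenbasis G d e .
  from lambda2_eigenvector_changes_sign[OF _ G(3)] G(2) n obtain y where
    "\<forall>u\<in>pverts G. (\<Sum>v | (u, v) \<in> parcs G. y v) = lambda2 G * y u"
    "\<exists>u\<in>pverts G. y u > 0" "\<exists>u\<in>pverts G. y u < 0" by metis
  then have L: "lambda2_extremal r n G y"
    by unfold_locales (use assms n max in \<open>auto simp: pos_part_def\<close>)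
  show "(odd n \<longrightarrow>
      (\<exists>A B. is_Gstar r ((n - 1) div 2) A \<and> is_Gstar r ((n - 1) div 2) B \<and>
        pverts A \<inter> pverts B = {} \<and> G \<in> I_family A B)) \<and>
    (even n \<longrightarrow>
      (\<exists>H1 H2. pair_graph H1 \<and> pair_graph H2 \<and>
        card (pverts H1) = n div 2 \<and> card (pverts H2) = n div 2 \<and>
        K_minor_saturated r H1 \<and> K_minor_saturated r H2 \<and>
        pverts H1 \<inter> pverts H2 = {} \<and> G \<in> E_family H1 H2))"
  proof (intro conjI impI)
    assume "odd n"
    then show "\<exists>A B. is_Gstar r ((n - 1) div 2) A \<and> is_Gstar r ((n - 1) div 2) B \<and>
        pverts A \<inter> pverts B = {} \<and> G \<in> I_family A B"
      by (intro odd_case[OF L]) simp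
  next
    assume "even n"
    then show "\<exists>H1 H2. pair_graph H1 \<and> pair_graph H2 \<and>
        card (pverts H1) = n div 2 \<and> card (pverts H2) = n div 2 \<and>
        K_minor_saturated r H1 \<and> K_minor_saturated r H2 \<and>
        pverts H1 \<inter> pverts H2 = {} \<and> G \<in> E_family H1 H2"
      by (intro even_case[OF L]) simp
  qed
qed

end
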